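(* Let $X$ be a reflexive real Banach space, let $\alpha:X\to X^*$ be a symplectic isomorphism and let $s:X\to X^*$ be a strictly singular operator. If $\alpha+s$ is also a symplectic isomorphism, then $\alpha$ and $\alpha+s$ are equivalent.
   Context: For a reflexive real Banach space $X$, an isomorphism (onto) $\alpha:X\to X^*$ is called symplectic if $\alpha^*=-\alpha$, where $\alpha^*:X^{**}=X\to X^*$ is the adjoint under the canonical identification; equivalently $\omega(x,y)=\alpha(x)(y)$ is a symplectic form. Two symplectic isomorphisms $\alpha,\beta:X\to X^*$ are equivalent if there is an onto isomorphism $T:X\to X$ with $\alpha=T^*\beta T$ (equivalently, the associated forms satisfy $\omega_\beta(Tx,Ty)=\omega_\alpha(x,y)$ for all $x,y\in X$). An operator is strictly singular if its restriction to no infinite-dimensional closed subspace is an isomorphism onto its image. *)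

theory Defs
  imports "HOL-Analysis.Analysis"
begin

type_synonym 'a dual = "'a \<Rightarrow>\<^sub>L real"

definition evaluation :: "'a::real_normed_vector \<Rightarrow> 'a dual dual" where
  "evaluation x = Blinfun (\<lambda>f. blinfun_apply f x)"

definition canonical_embedding :: "'a::real_normed_vector \<Rightarrow>\<^sub>L 'a dual dual" where
  "canonical_embedding = Blinfun evaluation"

definition reflexive_space :: "'a::real_normed_vector itself \<Rightarrow> bool" where
  "reflexive_space _ \<longleftrightarrow> surj (blinfun_apply (canonical_embedding :: 'a \<Rightarrow>\<^sub>L 'a dual dual))"

definition adjoint_blinfun ::
  "('a::real_normed_vector \<Rightarrow>\<^sub>L 'b::real_normed_vector) \<Rightarrow> 'b dual \<Rightarrow>\<^sub>L 'a dual" where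
  "adjoint_blinfun T = Blinfun (\<lambda>f. f o\<^sub>L T)"

text \<open>\<^const>\<open>Blinfun\<close> is unspecified outside the bounded linear maps; the next three
  lemmas show that it is applied to bounded linear maps above.\<close>

lemma evaluation_apply [simp]: "blinfun_apply (evaluation x) f = blinfun_apply f x"
  unfolding evaluation_def
  by (simp add: bounded_linear_Blinfun_apply
      bounded_bilinear.bounded_linear_left[OF bounded_bilinear_blinfun_apply])

lemma canonical_embedding_apply [simp]:
  "blinfun_apply canonical_embedding x = evaluation x"
proof -
  have "bounded_linear (evaluation :: 'a \<Rightarrow> 'a dual dual)"
  proof (rule bounded_linear_intro[where K = 1])
    fix x y :: 'a and r :: real
    show "evaluation (x + y) = evaluation x + evaluation y"
      by (rule blinfun_eqI) (simp add: blinfun.bilinear_simps)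
    show "evaluation (r *\<^sub>R x) = r *\<^sub>R evaluation x"
      by (rule blinfun_eqI) (simp add: blinfun.bilinear_simps)
    show "norm (evaluation x) \<le> norm x * 1"
    proof (rule norm_blinfun_bound)
      show "norm (blinfun_apply (evaluation x) f) \<le> norm x * 1 * norm f" for f :: "'a dual"
        using norm_blinfun[of f x] by (simp add: mult.commute)
    qed simp
  qed
  then show ?thesis
    unfolding canonical_embedding_def by (simp add: bounded_linear_Blinfun_apply)
qed

lemma adjoint_blinfun_apply [simp]: "blinfun_apply (adjoint_blinfun T) f = f o\<^sub>L T"
  unfolding adjoint_blinfun_def
  by (simp add: bounded_linear_Blinfun_apply
      bounded_bilinear.bounded_linear_left[OF bounded_bilinear_blinfun_compose])

text \<open>A bounded operator that is a homeomorphism between linear subspaces; linearity of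
  the inverse is automatic.\<close>

definition isomorphism_between ::
  "('a::real_normed_vector \<Rightarrow>\<^sub>L 'b::real_normed_vector) \<Rightarrow> 'a set \<Rightarrow> 'b set \<Rightarrow> bool" where
  "isomorphism_between T M N \<longleftrightarrow> (\<exists>g. homeomorphism M N (blinfun_apply T) g)"

definition symplectic_isomorphism :: "('a::real_normed_vector \<Rightarrow>\<^sub>L 'a dual) \<Rightarrow> bool" where
  "symplectic_isomorphism \<alpha> \<longleftrightarrow>
     isomorphism_between \<alpha> UNIV UNIV \<and> adjoint_blinfun \<alpha> o\<^sub>L canonical_embedding = - \<alpha>"

definition symplectically_equivalent ::
  "('a::real_normed_vector \<Rightarrow>\<^sub>L 'a dual) \<Rightarrow> ('a \<Rightarrow>\<^sub>L 'a dual) \<Rightarrow> bool" where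
  "symplectically_equivalent \<alpha> \<beta> \<longleftrightarrow>
     (\<exists>T :: 'a \<Rightarrow>\<^sub>L 'a. isomorphism_between T UNIV UNIV \<and>
        \<alpha> = adjoint_blinfun T o\<^sub>L \<beta> o\<^sub>L T)"

text \<open>Infinite-dimensionality is written as the absence of a finite spanning set, because
  \<^const>\<open>dim\<close> is 0 on infinite-dimensional subspaces.\<close>

definition strictly_singular ::
  "('a::real_normed_vector \<Rightarrow>\<^sub>L 'b::real_normed_vector) \<Rightarrow> bool" where
  "strictly_singular S \<longleftrightarrow>
     \<not> (\<exists>M. subspace M \<and> closed M \<and> \<not> (\<exists>B. finite B \<and> span B = M) \<and>
          isomorphism_between S M (blinfun_apply S ` M))"

end

theory Submission
  imports Defs
begin

text \<open>Along the segment \<alpha> + t s every operator is Fredholm, because a strictly singular perturbation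
  of an isomorphism is bounded below on an intersection of finitely many kernels of functionals.
  A skew operator with this property can be corrected by finitely many wedges of functionals so
  that its kernel has dimension at most one, and dimension one is impossible next to a symplectic
  isomorphism by a parity argument (bordering by one dimension would give a symplectic form on
  X plus a line). Skew perturbations that are small in norm do not change the equivalence class
  (take the self-adjoint square root of the quotient), and neither do sums of wedges (each wedge is
  undone by an explicit transvection-like map). Hence the set of t for which some correction of
  \<alpha> + t s by wedges is equivalent to \<alpha> is open and closed. At t = 1 the correction is removed
  again, since both operators are symplectic.\<close>

section \<open>Isomorphisms and lower bounds\<close>

text \<open>The obstacle is that \<alpha> + t s can be singular for some t between 0 and 1, so the
  segment need not consist of symplectic isomorphisms. One wedge repairs two kernel vectors at a
  time by pairing them; a single vector can be left over, and bordering pairs it with the added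
  line. After a correction at t0 the operator is only known to be bounded below. Surjectivity is
  imported: if some nearby t lies in the good set, the corrected operator at t is a finite-rank
  perturbation of an isomorphism, and injectivity implies surjectivity there; a small perturbation
  in norm then reaches all other nearby parameters. If a vector is left over, the bordered operator
  stays bounded below near t0, and parity keeps every nearby t out of the good set. So membership in
  that set is locally constant, which yields openness and closedness at once.\<close>

lemma blinfun_injI:
  fixes T :: "'a::real_normed_vector \<Rightarrow>\<^sub>L 'b::real_normed_vector"
  assumes "\<And>x. T x = 0 \<Longrightarrow> x = 0"
  shows "inj T"
proof (rule injI)
  fix x y assume "T x = T y"
  then show "x = y"
    using assms[of "x - y"] by (simp add: blinfun.diff_right)
qed

definition bounded_below_on ::
  "'a::real_normed_vector set \<Rightarrow> ('a \<Rightarrow>\<^sub>L 'b::real_normed_vector) \<Rightarrow> bool" where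
  "bounded_below_on N T \<longleftrightarrow> (\<exists>c>0. \<forall>x\<in>N. c * norm x \<le> norm (T x))"

lemma bounded_below_on_mono: "bounded_below_on N T \<Longrightarrow> M \<subseteq> N \<Longrightarrow> bounded_below_on M T"
  unfolding bounded_below_on_def by (meson subsetD)

lemma bounded_below_on_injD:
  assumes "bounded_below_on N T" "x \<in> N" "T x = 0"
  shows "x = 0"
proof -
  obtain c where "c > 0" "c * norm x \<le> norm (T x)"
    using assms unfolding bounded_below_on_def by blast
  then show ?thesis
    using assms(3) by (simp add: mult_le_0_iff)
qed

lemma bounded_below_imp_isomorphism_between:
  fixes T :: "'a::real_normed_vector \<Rightarrow>\<^sub>L 'b::real_normed_vector"
  assumes "bounded_below_on M T" "subspace M"
  shows "isomorphism_between T M (T ` M)"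
proof -
  obtain c where c: "c > 0" "\<And>x. x \<in> M \<Longrightarrow> c * norm x \<le> norm (T x)"
    using assms unfolding bounded_below_on_def by blast
  have lower: "c * dist x y \<le> dist (T x) (T y)" if "x \<in> M" "y \<in> M" for x y
    using c(2)[of "x - y"] subspace_diff[OF assms(2) that]
    by (simp add: dist_norm blinfun.diff_right)
  then have inj: "inj_on T M"
    using c(1) by (fastforce intro: inj_onI simp: mult_le_0_iff)
  have "continuous_on (T ` M) (the_inv_into M T)"
  proof (rule lipschitz_on_continuous_on[where L = "1 / c"], rule lipschitz_onI)
    fix u v assume "u \<in> T ` M" "v \<in> T ` M"
    then show "dist (the_inv_into M T u) (the_inv_into M T v) \<le> 1 / c * dist u v"
      using lower c(1) by (auto simp: the_inv_into_f_f[OF inj] field_simps)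
  qed (use c(1) in simp)
  then have "homeomorphism M (T ` M) T (the_inv_into M T)"
    unfolding homeomorphism_def
    by (auto simp: the_inv_into_f_f[OF inj] image_image f_the_inv_into_f[OF inj]
        intro!: continuous_intros)
  then show ?thesis
    unfolding isomorphism_between_def by blast
qed

text \<open>Continuity of the inverse at 0 gives the bound: if \<open>norm (T z) < \<delta>\<close>
  forces \<open>norm z < 1\<close>, then unit vectors have images of norm at least \<delta>. The
  quantitative form is what survives small perturbations.\<close>

lemma isomorphism_iff_bounded_below:
  fixes T :: "'a::real_normed_vector \<Rightarrow>\<^sub>L 'b::real_normed_vector"
  shows "isomorphism_between T UNIV UNIV \<longleftrightarrow> bounded_below_on UNIV T \<and> surj T"
proof (intro iffI conjI)
  assume "isomorphism_between T UNIV UNIV"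
  then obtain g where g: "homeomorphism UNIV UNIV T g"
    unfolding isomorphism_between_def by blast
  then show "surj T"
    by (simp add: homeomorphism_def)
  have gT: "g (T x) = x" for x
    using g by (simp add: homeomorphism_def)
  have "isCont g 0"
    using g by (simp add: homeomorphism_def continuous_on_eq_continuous_at)
  then obtain \<delta> where \<delta>: "\<delta> > 0" "\<And>y. dist y 0 < \<delta> \<Longrightarrow> dist (g y) (g 0) < 1"
    unfolding continuous_at_eps_delta by (metis zero_less_one)
  have g0: "g 0 = 0"
    using gT[of 0] by simp
  have "\<delta> * norm x \<le> norm (T x)" for x
  proof (cases "x = 0")
    case False
    let ?z = "(1 / norm x) *\<^sub>R x"
    have "norm (g (T ?z)) = 1"
      using False by (subst gT) simp
    then have "\<delta> \<le> norm (T ?z)"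
      using \<delta>(2)[of "T ?z"] g0 not_less by fastforce
    also have "\<dots> = norm (T x) / norm x"
      by (simp add: blinfun.scaleR_right)
    finally show ?thesis
      using False by (simp add: field_simps)
  qed simp
  then show "bounded_below_on UNIV T"
    using \<delta>(1) unfolding bounded_below_on_def by blast
next
  assume "bounded_below_on UNIV T \<and> surj T"
  then show "isomorphism_between T UNIV UNIV"
    using bounded_below_imp_isomorphism_between[of UNIV T] by simp
qed

lemma isomorphism_bij:
  fixes T :: "'a::real_normed_vector \<Rightarrow>\<^sub>L 'b::real_normed_vector"
  assumes "isomorphism_between T UNIV UNIV"
  shows "bij T"
  using assms unfolding isomorphism_iff_bounded_below bij_def
  by (blast intro: blinfun_injI bounded_below_on_injD)

lemma isomorphism_inverse:
  fixes T :: "'a::real_normed_vector \<Rightarrow>\<^sub>L 'b::real_normed_vector"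
  assumes "surj T" "c > 0" "\<And>x. c * norm x \<le> norm (T x)"
  obtains T' :: "'b \<Rightarrow>\<^sub>L 'a" where "T o\<^sub>L T' = id_blinfun" "T' o\<^sub>L T = id_blinfun" "norm T' \<le> 1 / c"
proof -
  have inj: "inj T"
  proof (rule blinfun_injI)
    fix x assume "T x = 0"
    then show "x = 0"
      using assms(2) assms(3)[of x] by (simp add: mult_le_0_iff)
  qed
  define g where "g = inv T"
  have gT: "g (T x) = x" and Tg: "T (g y) = y" for x y
    using assms(1) inj by (simp_all add: g_def surj_f_inv_f)
  have norm_g: "norm (g y) \<le> norm y * (1 / c)" for y
    using assms(3)[of "g y"] assms(2) by (simp add: Tg field_simps)
  have "bounded_linear g"
  proof (rule bounded_linear_intro[OF _ _ norm_g])
    show "g (x + y) = g x + g y" for x y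
      by (metis Tg gT blinfun.add_right)
    show "g (r *\<^sub>R x) = r *\<^sub>R g x" for r x
      by (metis Tg gT blinfun.scaleR_right)
  qed
  then have ap: "blinfun_apply (Blinfun g) = g"
    by (rule bounded_linear_Blinfun_apply)
  show ?thesis
  proof (rule that[of "Blinfun g"])
    show "T o\<^sub>L Blinfun g = id_blinfun" "Blinfun g o\<^sub>L T = id_blinfun"
      by (rule blinfun_eqI; simp add: ap gT Tg)+
    show "norm (Blinfun g) \<le> 1 / c"
      using norm_g assms(2) by (intro norm_blinfun_bound) (simp_all add: ap mult.commute)
  qed
qed

lemma isomorphism_iff_inverse:
  fixes T :: "'a::real_normed_vector \<Rightarrow>\<^sub>L 'b::real_normed_vector"
  shows "isomorphism_between T UNIV UNIV \<longleftrightarrow>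
    (\<exists>T' :: 'b \<Rightarrow>\<^sub>L 'a. T o\<^sub>L T' = id_blinfun \<and> T' o\<^sub>L T = id_blinfun)"
proof
  assume "isomorphism_between T UNIV UNIV"
  then obtain c where c: "surj T" "c > 0" "\<And>x. c * norm x \<le> norm (T x)"
    unfolding isomorphism_iff_bounded_below bounded_below_on_def by auto
  show "\<exists>T' :: 'b \<Rightarrow>\<^sub>L 'a. T o\<^sub>L T' = id_blinfun \<and> T' o\<^sub>L T = id_blinfun"
    by (rule isomorphism_inverse[OF c]) blast
next
  assume "\<exists>T' :: 'b \<Rightarrow>\<^sub>L 'a. T o\<^sub>L T' = id_blinfun \<and> T' o\<^sub>L T = id_blinfun"
  then obtain T' :: "'b \<Rightarrow>\<^sub>L 'a" where "T o\<^sub>L T' = id_blinfun" "T' o\<^sub>L T = id_blinfun"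
    by blast
  then have "T (T' y) = y" "T' (T x) = x" for x y
    by (metis blinfun_apply_blinfun_compose blinfun_apply_id_blinfun)+
  then have "homeomorphism UNIV UNIV T T'"
    by (intro homeomorphismI) (auto intro: continuous_intros)
  then show "isomorphism_between T UNIV UNIV"
    unfolding isomorphism_between_def by blast
qed

lemma isomorphism_compose:
  fixes S :: "'b::real_normed_vector \<Rightarrow>\<^sub>L 'c::real_normed_vector"
    and T :: "'a::real_normed_vector \<Rightarrow>\<^sub>L 'b"
  assumes "isomorphism_between S UNIV UNIV" "isomorphism_between T UNIV UNIV"
  shows "isomorphism_between (S o\<^sub>L T) UNIV UNIV"
proof -
  obtain f g where "homeomorphism UNIV UNIV S f" "homeomorphism UNIV UNIV T g"
    using assms unfolding isomorphism_between_def by blast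
  then have "homeomorphism UNIV UNIV (S o\<^sub>L T) (g \<circ> f)"
    using homeomorphism_compose by (simp add: blinfun_compose.rep_eq)
  then show ?thesis
    unfolding isomorphism_between_def by blast
qed

lemma isomorphism_adjoint:
  fixes T :: "'a::real_normed_vector \<Rightarrow>\<^sub>L 'b::real_normed_vector"
  assumes "isomorphism_between T UNIV UNIV"
  shows "isomorphism_between (adjoint_blinfun T) UNIV UNIV"
proof -
  obtain T' :: "'b \<Rightarrow>\<^sub>L 'a" where "T o\<^sub>L T' = id_blinfun" "T' o\<^sub>L T = id_blinfun"
    using assms unfolding isomorphism_iff_inverse by blast
  then have "T (T' y) = y" "T' (T x) = x" for x y
    by (metis blinfun_apply_blinfun_compose blinfun_apply_id_blinfun)+
  then have "adjoint_blinfun T o\<^sub>L adjoint_blinfun T' = id_blinfun"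
    "adjoint_blinfun T' o\<^sub>L adjoint_blinfun T = id_blinfun"
    by (intro blinfun_eqI; simp)+
  then show ?thesis
    unfolding isomorphism_iff_inverse by blast
qed

lemma isomorphism_near_id:
  fixes R :: "'a::banach \<Rightarrow>\<^sub>L 'a"
  assumes "norm R < 1"
  shows "isomorphism_between (id_blinfun + R) UNIV UNIV"
  unfolding isomorphism_iff_bounded_below
proof
  have nR: "norm (R x) \<le> norm R * norm x" for x
    by (rule norm_blinfun)
  have "(1 - norm R) * norm x \<le> norm ((id_blinfun + R) x)" for x
    using nR[of x] norm_diff_ineq[of x "R x"] by (simp add: blinfun.add_left algebra_simps)
  then show "bounded_below_on UNIV (id_blinfun + R)"
    using assms unfolding bounded_below_on_def by (intro exI[of _ "1 - norm R"]) simp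
  have "\<exists>x. y = (id_blinfun + R) x" for y
  proof -
    have "\<exists>!x. y - R x = x"
    proof (rule banach_fix_type)
      show "\<forall>x x'. dist (y - R x) (y - R x') \<le> norm R * dist x x'"
        using nR[of "_ - _"] by (auto simp: dist_norm blinfun.diff_right norm_minus_commute)
    qed (use assms in auto)
    then obtain x where "y - R x = x" by blast
    then show ?thesis
      by (intro exI[of _ x]) (simp add: blinfun.add_left algebra_simps)
  qed
  then show "surj (id_blinfun + R)"
    unfolding surj_def by blast
qed

section \<open>Skew operators and equivalence\<close>

text \<open>Skewness is kept apart from invertibility, because \<alpha> + t s and its corrections
  may be singular.\<close>

definition skew :: "('a::real_normed_vector \<Rightarrow>\<^sub>L 'a dual) \<Rightarrow> bool" where
  "skew C \<longleftrightarrow> (\<forall>x y. C x y = - C y x)"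

lemma skewD: "skew C \<Longrightarrow> C x y = - C y x"
  unfolding skew_def by blast

lemma skew_self: "skew C \<Longrightarrow> C x x = 0"
  using skewD[of C x x] by linarith

lemma skew_add: "skew C \<Longrightarrow> skew D \<Longrightarrow> skew (C + D)"
  and skew_diff: "skew C \<Longrightarrow> skew D \<Longrightarrow> skew (C - D)"
  and skew_scaleR: "skew C \<Longrightarrow> skew (r *\<^sub>R C)"
proof -
  show "skew (C + D)" if "skew C" "skew D"
    using skewD[OF that(1)] skewD[OF that(2)]
    unfolding skew_def blinfun.add_left by (metis minus_add_distrib)
  show "skew (C - D)" if "skew C" "skew D"
    using skewD[OF that(1)] skewD[OF that(2)]
    unfolding skew_def blinfun.diff_left by (metis minus_diff_minus)
  show "skew (r *\<^sub>R C)" if "skew C"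
    using skewD[OF that]
    unfolding skew_def blinfun.scaleR_left by (metis mult_minus_right real_scaleR_def)
qed

lemma symplectic_isomorphism_iff:
  "symplectic_isomorphism C \<longleftrightarrow> isomorphism_between C UNIV UNIV \<and> skew C"
proof -
  have "adjoint_blinfun C o\<^sub>L canonical_embedding = - C \<longleftrightarrow>
      (\<forall>x y. (adjoint_blinfun C o\<^sub>L canonical_embedding) x y = (- C) x y)"
    by (metis blinfun_eqI)
  then have "adjoint_blinfun C o\<^sub>L canonical_embedding = - C \<longleftrightarrow> (\<forall>x y. C y x = - C x y)"
    by (simp add: blinfun.minus_left)
  then show ?thesis
    unfolding symplectic_isomorphism_def skew_def by blast
qed

lemma symplectically_equivalent_iff:
  fixes \<alpha> \<beta> :: "'a::real_normed_vector \<Rightarrow>\<^sub>L 'a dual"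
  shows "symplectically_equivalent \<alpha> \<beta> \<longleftrightarrow>
    (\<exists>T. isomorphism_between T UNIV UNIV \<and> (\<forall>x y. \<alpha> x y = \<beta> (T x) (T y)))"
proof -
  have "\<alpha> = adjoint_blinfun T o\<^sub>L \<beta> o\<^sub>L T \<longleftrightarrow> (\<forall>x y. \<alpha> x y = \<beta> (T x) (T y))" for T
    by (auto intro!: blinfun_eqI)
  then show ?thesis
    unfolding symplectically_equivalent_def by simp
qed

lemma symplectically_equivalent_sym:
  assumes "symplectically_equivalent \<alpha> \<beta>"
  shows "symplectically_equivalent \<beta> \<alpha>"
proof -
  obtain T where T: "isomorphism_between T UNIV UNIV" "\<forall>x y. \<alpha> x y = \<beta> (T x) (T y)"
    using assms unfolding symplectically_equivalent_iff by blast
  obtain T' where T': "T o\<^sub>L T' = id_blinfun" "T' o\<^sub>L T = id_blinfun"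
    using T(1) unfolding isomorphism_iff_inverse by blast
  have "isomorphism_between T' UNIV UNIV"
    using T' unfolding isomorphism_iff_inverse by blast
  moreover have "T (T' x) = x" for x
    using T'(1) by (metis blinfun_apply_blinfun_compose blinfun_apply_id_blinfun)
  then have "\<forall>x y. \<beta> x y = \<alpha> (T' x) (T' y)"
    by (simp add: T(2))
  ultimately show ?thesis
    unfolding symplectically_equivalent_iff by blast
qed

lemma symplectically_equivalent_trans:
  assumes "symplectically_equivalent \<alpha> \<beta>" "symplectically_equivalent \<beta> \<gamma>"
  shows "symplectically_equivalent \<alpha> \<gamma>"
proof -
  obtain T S where "isomorphism_between T UNIV UNIV" "\<forall>x y. \<alpha> x y = \<beta> (T x) (T y)"
    "isomorphism_between S UNIV UNIV" "\<forall>x y. \<beta> x y = \<gamma> (S x) (S y)"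
    using assms unfolding symplectically_equivalent_iff by blast
  then show ?thesis
    using isomorphism_compose unfolding symplectically_equivalent_iff
    by (intro exI[of _ "S o\<^sub>L T"]) auto
qed

lemma symplectic_isomorphism_equivalent:
  assumes "symplectically_equivalent \<alpha> \<beta>" "symplectic_isomorphism \<beta>"
  shows "symplectic_isomorphism \<alpha>"
proof -
  obtain T where T: "isomorphism_between T UNIV UNIV" "\<alpha> = adjoint_blinfun T o\<^sub>L \<beta> o\<^sub>L T"
    using assms(1) unfolding symplectically_equivalent_def by blast
  have "isomorphism_between \<alpha> UNIV UNIV"
    unfolding T(2) using T(1) assms(2) isomorphism_adjoint[OF T(1)] symplectic_isomorphism_iff[of \<beta>]
    by (intro isomorphism_compose) auto
  moreover have "skew \<alpha>"
    unfolding skew_def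
  proof (intro allI)
    show "\<alpha> x y = - \<alpha> y x" for x y
      using skewD[of \<beta> "T x" "T y"] assms(2) by (simp add: T(2) symplectic_isomorphism_iff)
  qed
  ultimately show ?thesis
    unfolding symplectic_isomorphism_iff by blast
qed

text \<open>With S the inverse of C followed after \<delta>, the sum is C (id + S), and S is
  self-adjoint for the form C since C and \<delta> are skew. If T is self-adjoint with T T = id + S,
  then C (T x) (T y) = C (T (T x)) y is the perturbed form. The bound c / 4 gives
  \<open>norm S \<le> 1 / 4\<close>, small enough to find the root as a fixed point in the ball of
  radius 1/2.\<close>

lemma symplectic_isomorphism_perturb:
  fixes C \<delta> :: "'a::banach \<Rightarrow>\<^sub>L 'a dual"
  assumes C: "symplectic_isomorphism C" and c: "c > 0" "\<And>x. c * norm x \<le> norm (C x)"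
    and \<delta>: "skew \<delta>" "norm \<delta> \<le> c / 4"
  shows "symplectic_isomorphism (C + \<delta>)" "symplectically_equivalent (C + \<delta>) C"
proof -
  have skC: "skew C" and "surj C"
    using C unfolding symplectic_isomorphism_iff isomorphism_iff_bounded_below by auto
  obtain C' where C': "C o\<^sub>L C' = id_blinfun" "norm C' \<le> 1 / c"
    by (rule isomorphism_inverse[OF \<open>surj C\<close> c])
  define S where "S = C' o\<^sub>L \<delta>"
  have CS: "C (S x) = \<delta> x" for x
    using C'(1) unfolding S_def by (metis blinfun_apply_blinfun_compose blinfun_apply_id_blinfun)
  have "norm S \<le> norm C' * norm \<delta>"
    unfolding S_def by (rule norm_blinfun_compose)
  also have "\<dots> \<le> (1 / c) * (c / 4)"
    using C'(2) \<delta>(2) c(1) by (intro mult_mono) auto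
  finally have nS: "norm S \<le> 1 / 4"
    using c(1) by simp
  define V where "V = {R :: 'a \<Rightarrow>\<^sub>L 'a. norm R \<le> 1 / 2 \<and> 
    (\<forall>x y. C (blinfun_apply R x) y = C x (blinfun_apply R y))}"
  \<comment> \<open>Expanding (id + R) (id + R) = id + S gives 2 R = S - R R, so the fixed points of
    this map are the wanted roots. On \<open>V\<close>, which also records self-adjointness, radius
    1/2 makes it a contraction with factor 1/2.\<close>
  define \<Phi> where "\<Phi> = (\<lambda>R. (1 / 2) *\<^sub>R (S - (R o\<^sub>L R)))"
  have "V = cball 0 (1 / 2) \<inter> (\<Inter>x y. {R. C (blinfun_apply R x) y = C x (blinfun_apply R y)})"
    unfolding V_def by auto
  moreover have "closed {R. C (blinfun_apply R x) y = C x (blinfun_apply R y)}" for x y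
    by (intro closed_Collect_eq continuous_intros)
  ultimately have "closed V"
    by (simp add: closed_INT closed_Int)
  then have "complete V"
    by (simp add: complete_eq_closed)
  moreover have "0 \<in> V"
    unfolding V_def by simp
  moreover have "\<Phi> R \<in> V" if "R \<in> V" for R
  proof -
    have "norm (R o\<^sub>L R) \<le> norm R * norm R"
      by (rule norm_blinfun_compose)
    also have "\<dots> \<le> (1 / 2) * (1 / 2)"
      using that unfolding V_def by (intro mult_mono) auto
    finally have "norm (S - (R o\<^sub>L R)) \<le> 1 / 2"
      using nS norm_triangle_ineq4[of S "R o\<^sub>L R"] by simp
    then have "norm (\<Phi> R) \<le> 1 / 2"
      unfolding \<Phi>_def by simp
    moreover have "C (\<Phi> R x) y = C x (\<Phi> R y)" for x y
    proof -
      have "C x (S y) = \<delta> x y"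
        using skewD[OF skC, of x "S y"] skewD[OF \<delta>(1), of y x] by (simp add: CS)
      then show ?thesis
        using that unfolding \<Phi>_def V_def by (simp add: blinfun.bilinear_simps CS)
    qed
    ultimately show ?thesis
      unfolding V_def by blast
  qed
  moreover have "dist (\<Phi> R) (\<Phi> R') \<le> (1 / 2) * dist R R'" if "R \<in> V" "R' \<in> V" for R R'
  proof -
    \<comment> \<open>The difference of two squares, written for operators that need not
      commute.\<close>
    have "\<Phi> R' - \<Phi> R = (1 / 2) *\<^sub>R ((R o\<^sub>L (R - R')) + ((R - R') o\<^sub>L R'))"
      unfolding \<Phi>_def by (intro blinfun_eqI) (simp add: blinfun.bilinear_simps algebra_simps)
    then have "norm (\<Phi> R' - \<Phi> R) = norm ((R o\<^sub>L (R - R')) + ((R - R') o\<^sub>L R')) / 2"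
      by simp
    also have "\<dots> \<le> (norm R * norm (R - R') + norm (R - R') * norm R') / 2"
      using norm_triangle_ineq[of "R o\<^sub>L (R - R')" "(R - R') o\<^sub>L R'"]
        norm_blinfun_compose[of R "R - R'"] norm_blinfun_compose[of "R - R'" R'] by simp
    also have "\<dots> \<le> ((1 / 2) * norm (R - R') + norm (R - R') * (1 / 2)) / 2"
      using that unfolding V_def by (intro divide_right_mono add_mono mult_mono) auto
    finally show ?thesis
      by (simp add: dist_norm norm_minus_commute)
  qed
  ultimately have "\<exists>!R. R \<in> V \<and> \<Phi> R = R"
    by (intro Banach_fix[of V "1 / 2"]) auto
  then obtain R where R: "R \<in> V" "\<Phi> R = R" by blast
  \<comment> \<open>id + R is the self-adjoint square root of id + S.\<close>
  define T where "T = id_blinfun + R"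
  have isoT: "isomorphism_between T UNIV UNIV"
    using R(1) unfolding T_def V_def by (intro isomorphism_near_id) auto
  have "(C + \<delta>) x y = C (T x) (T y)" for x y
  proof -
    have sa: "C (R x) y = C x (R y)" for x y
      using R(1) unfolding V_def by blast
    have "2 *\<^sub>R R x = 2 *\<^sub>R \<Phi> R x"
      by (simp add: R(2))
    also have "\<dots> = S x - R (R x)"
      unfolding \<Phi>_def by (simp add: blinfun.bilinear_simps)
    finally have RR: "R (R x) = S x - 2 *\<^sub>R R x" by simp
    have "C (R x) (R y) = \<delta> x y - 2 * C (R x) y"
      unfolding sa[of "R x" y, symmetric] RR by (simp add: blinfun.bilinear_simps CS)
    then show ?thesis
      unfolding T_def by (simp add: blinfun.bilinear_simps sa)
  qed
  then show "symplectically_equivalent (C + \<delta>) C"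
    using isoT unfolding symplectically_equivalent_iff by blast
  then show "symplectic_isomorphism (C + \<delta>)"
    using C by (rule symplectic_isomorphism_equivalent)
qed

section \<open>Finite-rank perturbations\<close>

definition rank_one ::
  "'a::real_normed_vector dual \<Rightarrow> 'b::real_normed_vector \<Rightarrow> 'a \<Rightarrow>\<^sub>L 'b" where
  "rank_one \<phi> y = blinfun_scaleR_left y o\<^sub>L \<phi>"

lemma rank_one_apply [simp]: "rank_one \<phi> y x = \<phi> x *\<^sub>R y"
  unfolding rank_one_def by simp

lemma rank_one_scaleR: "rank_one \<phi> (k *\<^sub>R y) = k *\<^sub>R rank_one \<phi> y"
  by (rule blinfun_eqI) (simp add: blinfun.scaleR_left)

definition finite_rank :: "('a::real_normed_vector \<Rightarrow>\<^sub>L 'b::real_normed_vector) set" where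
  "finite_rank = span {rank_one \<phi> y | \<phi> y. True}"

lemma rank_one_finite_rank: "rank_one \<phi> y \<in> finite_rank"
  unfolding finite_rank_def by (rule span_base) blast

lemma finite_rank_add: "f \<in> finite_rank \<Longrightarrow> g \<in> finite_rank \<Longrightarrow> f + g \<in> finite_rank"
  unfolding finite_rank_def by (rule span_add)

text \<open>The perturbed operator is E composed with x \<mapsto> x + \<phi> x w, and 1 + \<phi> w
  is the determinant of that map.\<close>

lemma bij_add_rank_one_iff:
  fixes E :: "'a::real_normed_vector \<Rightarrow>\<^sub>L 'b::real_normed_vector" and \<phi> :: "'a dual"
  assumes "bij E" "E w = y"
  shows "1 + \<phi> w \<noteq> 0 \<Longrightarrow> bij (E + rank_one \<phi> y)"
    and "inj (E + rank_one \<phi> y) \<Longrightarrow> 1 + \<phi> w \<noteq> 0"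
proof -
  have E: "(E + rank_one \<phi> y) x = E (x + \<phi> x *\<^sub>R w)" for x
    by (simp add: blinfun.bilinear_simps assms(2))
  have inj: "x = x'" if "E x = E x'" for x x'
    using that assms(1) by (metis bij_def injD)
  show "bij (E + rank_one \<phi> y)" if d: "1 + \<phi> w \<noteq> 0"
  proof (rule bijI)
    show "inj (E + rank_one \<phi> y)"
    proof (rule injI)
      fix x x' assume "(E + rank_one \<phi> y) x = (E + rank_one \<phi> y) x'"
      then have eq: "x + \<phi> x *\<^sub>R w = x' + \<phi> x' *\<^sub>R w"
        unfolding E by (rule inj)
      then have "\<phi> (x + \<phi> x *\<^sub>R w) = \<phi> (x' + \<phi> x' *\<^sub>R w)"
        by simp
      then have "\<phi> x * (1 + \<phi> w) = \<phi> x' * (1 + \<phi> w)"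
        by (simp add: blinfun.bilinear_simps algebra_simps)
      then show "x = x'"
        using eq d by simp
    qed
    show "surj (E + rank_one \<phi> y)"
      unfolding surj_def
    proof
      fix u
      obtain v where v: "u = E v"
        using assms(1) by (metis bij_pointE)
      \<comment> \<open>The Sherman-Morrison formula gives this preimage.\<close>
      have "\<phi> (v - (\<phi> v / (1 + \<phi> w)) *\<^sub>R w) = \<phi> v / (1 + \<phi> w)"
        using d by (simp add: blinfun.bilinear_simps field_simps)
      then have "u = (E + rank_one \<phi> y) (v - (\<phi> v / (1 + \<phi> w)) *\<^sub>R w)"
        unfolding E v by simp
      then show "\<exists>x. u = (E + rank_one \<phi> y) x" ..
    qed
  qed
  show "1 + \<phi> w \<noteq> 0" if "inj (E + rank_one \<phi> y)"
  proof
    assume d: "1 + \<phi> w = 0"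
    then have "w + \<phi> w *\<^sub>R w = 0"
      by (metis scaleR_add_left scaleR_one scaleR_zero_left)
    then have "(E + rank_one \<phi> y) w = (E + rank_one \<phi> y) 0"
      unfolding E by simp
    then have "w = 0"
      using that by (metis injD)
    then show False
      using d by simp
  qed
qed

text \<open>Each factor is affine in k and equals 1 at k = 0 or k = 1 respectively. If neither of
  these values serves, the factors are 1 - k and k, and 1/2 works.\<close>

lemma exists_avoiding_parameter: "\<exists>k::real. 1 + k * m \<noteq> 0 \<and> 1 + (k - 1) * m' \<noteq> 0"
proof -
  consider "m' \<noteq> 1" | "m \<noteq> - 1" | "m = - 1" "m' = 1" by blast
  then show ?thesis
  proof cases
    case 1 then show ?thesis by (intro exI[of _ 0]) simp
  next
    case 2 then show ?thesis by (intro exI[of _ 1]) auto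
  next
    case 3 then show ?thesis by (intro exI[of _ "1 / 2"]) simp
  qed
qed

text \<open>In this induction, and in the two inductions on sums of wedges below, a rank-one (or
  wedge) summand is split as k g + (1 - k) g, where k is chosen such that moving k g to the
  first operator and removing (1 - k) g from the second one both preserve invertibility.\<close>

lemma finite_rank_inj_imp_surj:
  fixes E :: "'a::real_normed_vector \<Rightarrow>\<^sub>L 'b::real_normed_vector"
  assumes "f \<in> finite_rank" "bij E" "inj (E + f)"
  shows "surj (E + f)"
  using assms(1)[unfolded finite_rank_def] assms(2,3)
proof (induction f arbitrary: E rule: span_induct_alt)
  case base
  then show ?case by (simp add: bij_def)
next
  case (step c r f)
  then obtain \<phi> y where "r = rank_one \<phi> y" by blast
  define v where "v = c *\<^sub>R y"
  have cr: "c *\<^sub>R r = rank_one \<phi> v"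
    unfolding v_def \<open>r = rank_one \<phi> y\<close> by (rule rank_one_scaleR[symmetric])
  define D where "D = E + (c *\<^sub>R r + f)"
  have injD: "x = x'" if "D x = D x'" for x x'
    using step.prems(2) that unfolding D_def by (metis injD)
  obtain w where w: "E w = v"
    using step.prems(1) by (metis bij_pointE)
  \<comment> \<open>Whether v is in the range of D is not known yet. By injectivity it has at most
    one preimage, and m' is the value of \<phi> there; without a preimage, m' is arbitrary.\<close>
  obtain m' where m': "\<And>z. D z = v \<Longrightarrow> \<phi> z = m'"
    using injD by metis
  obtain k where k: "1 + k * \<phi> w \<noteq> 0" "1 + (k - 1) * m' \<noteq> 0"
    using exists_avoiding_parameter by blast
  define E' where "E' = E + rank_one \<phi> (k *\<^sub>R v)"
  have "bij E'"
    unfolding E'_def using k(1)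
    by (intro bij_add_rank_one_iff(1)[OF step.prems(1), of "k *\<^sub>R w"])
      (simp_all add: w blinfun.scaleR_right)
  have E'_D: "(E' + f) x = D x + ((k - 1) * \<phi> x) *\<^sub>R v" for x
    unfolding E'_def D_def cr by (simp add: blinfun.bilinear_simps algebra_simps)
  have "x = 0" if "(E' + f) x = 0" for x
  proof -
    \<comment> \<open>A kernel vector of E' + f satisfies D x = t v. If t were nonzero, v would have
      the preimage x / t, hence \<phi> x = t m', and the choice of k would be violated.\<close>
    define t where "t = (1 - k) * \<phi> x"
    have Dx: "D x = t *\<^sub>R v"
      using that unfolding E'_D t_def by (simp add: algebra_simps eq_neg_iff_add_eq_0)
    have "t = 0"
    proof (rule ccontr)
      assume "t \<noteq> 0"
      then have "D ((1 / t) *\<^sub>R x) = v"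
        by (simp add: Dx blinfun.scaleR_right)
      then have "\<phi> x = t * m'"
        using m'[of "(1 / t) *\<^sub>R x"] \<open>t \<noteq> 0\<close> by (simp add: blinfun.scaleR_right field_simps)
      then have "\<phi> x * (1 + (k - 1) * m') = 0"
        unfolding t_def by (simp add: algebra_simps)
      then show False
        using k(2) \<open>t \<noteq> 0\<close> unfolding t_def by simp
    qed
    then show ?thesis
      using Dx injD[of x 0] by simp
  qed
  then have "inj (E' + f)"
    by (rule blinfun_injI)
  then have "bij (E' + f)"
    using step.IH[OF \<open>bij E'\<close>] by (simp add: bij_def)
  moreover have D: "D = (E' + f) + rank_one \<phi> ((1 - k) *\<^sub>R v)"
    by (rule blinfun_eqI, subst blinfun.add_left, subst E'_D) (simp add: algebra_simps)
  moreover obtain z where "(E' + f) z = (1 - k) *\<^sub>R v"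
    using \<open>bij (E' + f)\<close> by (metis bij_pointE)
  \<comment> \<open>The rank-one criterion is used in both directions: injectivity of D makes its
    factor nonzero, and the nonzero factor makes D bijective.\<close>
  ultimately have "bij D"
    using bij_add_rank_one_iff[of "E' + f" z "(1 - k) *\<^sub>R v" \<phi>] step.prems(2)
    unfolding D_def by metis
  then show ?case
    unfolding D_def by (simp add: bij_def)
qed

text \<open>The inverse is again the identity plus a rank-one map; its coefficient r solves r + 1 +
  r \<phi> u = 0. This explicit form shows that it is bounded.\<close>

lemma isomorphism_id_rank_one:
  fixes \<phi> :: "'a::real_normed_vector dual"
  assumes "1 + \<phi> u \<noteq> 0"
  shows "isomorphism_between (id_blinfun + rank_one \<phi> u) UNIV UNIV"
proof -
  define r where "r = - 1 / (1 + \<phi> u)"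
  have r: "r + 1 + r * \<phi> u = 0"
    using assms unfolding r_def by (simp add: field_simps)
  have "\<phi> x *\<^sub>R u + ((r * \<phi> x) *\<^sub>R u + (r * (\<phi> x * \<phi> u)) *\<^sub>R u) = 0" for x
  proof -
    have "\<phi> x + (r * \<phi> x + r * (\<phi> x * \<phi> u)) = \<phi> x * (r + 1 + r * \<phi> u)"
      by (simp add: algebra_simps)
    then show ?thesis
      by (simp add: r flip: scaleR_add_left)
  qed
  then have "(id_blinfun + rank_one \<phi> u) o\<^sub>L (id_blinfun + rank_one \<phi> (r *\<^sub>R u)) = id_blinfun"
    "(id_blinfun + rank_one \<phi> (r *\<^sub>R u)) o\<^sub>L (id_blinfun + rank_one \<phi> u) = id_blinfun"
    by (intro blinfun_eqI; simp add: blinfun.bilinear_simps algebra_simps)+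
  then show ?thesis
    unfolding isomorphism_iff_inverse by blast
qed

section \<open>Wedges of functionals and the maps that absorb them\<close>

definition wedge :: "'a::real_normed_vector dual \<Rightarrow> 'a dual \<Rightarrow> 'a \<Rightarrow>\<^sub>L 'a dual" where
  "wedge a b = rank_one a b - rank_one b a"

lemma wedge_apply [simp]: "wedge a b x y = a x * b y - b x * a y"
  unfolding wedge_def by (simp add: blinfun.bilinear_simps)

lemma wedge_apply1: "wedge a b x = a x *\<^sub>R b - b x *\<^sub>R a"
  unfolding wedge_def by (simp add: blinfun.bilinear_simps)

lemma wedge_scaleR: "wedge (k *\<^sub>R a) b = k *\<^sub>R wedge a b"
  by (intro blinfun_eqI) (simp add: blinfun.bilinear_simps algebra_simps)

lemma skew_wedge: "skew (wedge a b)"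
  unfolding skew_def by simp

definition wedge_sums :: "('a::real_normed_vector \<Rightarrow>\<^sub>L 'a dual) set" where
  "wedge_sums = span {wedge a b | a b. True}"

lemma wedge_in_wedge_sums: "wedge a b \<in> wedge_sums"
  unfolding wedge_sums_def by (rule span_base) blast

lemma wedge_sums_0: "0 \<in> wedge_sums"
  and wedge_sums_add: "f \<in> wedge_sums \<Longrightarrow> g \<in> wedge_sums \<Longrightarrow> f + g \<in> wedge_sums"
  and wedge_sums_diff: "f \<in> wedge_sums \<Longrightarrow> g \<in> wedge_sums \<Longrightarrow> f - g \<in> wedge_sums"
  unfolding wedge_sums_def by (rule span_0 span_add span_diff; assumption)+

text \<open>Scalars are absorbed into the first factor, so each induction step adds a plain
  wedge.\<close>

lemma wedge_sums_induct [consumes 1, case_names zero add]: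
  assumes "f \<in> wedge_sums" "P 0" "\<And>a b f. P f \<Longrightarrow> P (wedge a b + f)"
  shows "P f"
  using assms(1)[unfolded wedge_sums_def]
proof (induction rule: span_induct_alt)
  case (step c g f)
  then obtain a b where "g = wedge a b" by blast
  then show ?case
    using assms(3)[OF step(2), of "c *\<^sub>R a" b] by (simp add: wedge_scaleR)
qed (fact assms(2))

lemma wedge_sums_skew:
  assumes "f \<in> wedge_sums"
  shows "skew f"
  using assms
proof (induction rule: wedge_sums_induct)
  case zero
  show ?case by (simp add: skew_def)
next
  case (add a b f)
  then show ?case by (intro skew_add skew_wedge)
qed

lemma wedge_sums_finite_rank:
  assumes "f \<in> wedge_sums"
  shows "f \<in> finite_rank"
  using assms
proof (induction rule: wedge_sums_induct)
  case zero
  show ?case unfolding finite_rank_def by (rule span_0)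
next
  case (add a b f)
  have "wedge a b = rank_one a b + rank_one (- b) a"
    by (intro blinfun_eqI) (simp add: blinfun.bilinear_simps)
  then show ?case
    using add by (metis finite_rank_add rank_one_finite_rank)
qed

text \<open>The map T moves x by r (C v x) u with r = 1 / (1 + C u v). It preserves the functional C
  u, because C u u = 0, and multiplies C v by r. So the pulled-back wedge is r times the old one,
  and this cancels the change that T makes in C.\<close>

lemma wedge_perturbation_equivalent:
  fixes C :: "'a::real_normed_vector \<Rightarrow>\<^sub>L 'a dual"
  assumes "skew C" and d: "1 + C u v \<noteq> 0"
  shows "symplectically_equivalent C (C + wedge (C u) (C v))"
proof -
  define r where "r = 1 / (1 + C u v)"
  have r: "r * (1 + C u v) = 1"
    using d unfolding r_def by simp
  define T where "T = id_blinfun + rank_one (r *\<^sub>R C v) u"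
  have "1 + (r *\<^sub>R C v) u = r"
    using r skewD[OF assms(1), of v u] by (simp add: blinfun.scaleR_left algebra_simps)
  then have "isomorphism_between T UNIV UNIV"
    unfolding T_def using r by (intro isomorphism_id_rank_one) auto
  moreover have "C x y = (C + wedge (C u) (C v)) (T x) (T y)" for x y
  proof -
    have sk: "C x u = - C u x" "C x v = - C v x" for x
      using skewD[OF assms(1)] by blast+
    define g where "g = C u x * C v y - C v x * C u y"
    have T: "T x = x + (r * C v x) *\<^sub>R u" for x
      unfolding T_def by (simp add: blinfun.bilinear_simps)
    have u: "C u (T x) = C u x" for x
      unfolding T by (simp add: blinfun.bilinear_simps skew_self[OF assms(1)])
    have v: "C v (T x) = r * C v x" for x
    proof -
      have "C v (T x) = C v x * (1 - r * C u v)"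
        unfolding T using sk(1)[of v] by (simp add: blinfun.bilinear_simps algebra_simps)
      also have "1 - r * C u v = r"
        using r by (simp add: algebra_simps)
      finally show ?thesis by simp
    qed
    have "C (T x) (T y) = C x y - r * g"
      unfolding T g_def using sk(1)[of x]
      by (simp add: blinfun.bilinear_simps skew_self[OF assms(1)] algebra_simps)
    moreover have "wedge (C u) (C v) (T x) (T y) = r * g"
      unfolding g_def by (simp add: u v algebra_simps)
    ultimately show ?thesis
      by (simp add: blinfun.add_left)
  qed
  ultimately show ?thesis
    unfolding symplectically_equivalent_iff by blast
qed

text \<open>Scaling the wedge scales u alone, so the obstruction is affine in k and at most one k is
  lost.\<close>

lemma wedge_perturbation_generic:
  fixes C :: "'a::real_normed_vector \<Rightarrow>\<^sub>L 'a dual"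
  assumes "symplectic_isomorphism C"
  obtains m where "\<And>k. 1 + k * m \<noteq> 0 \<Longrightarrow> symplectically_equivalent (C + k *\<^sub>R wedge a b) C"
proof -
  have C: "bij C" "skew C"
    using assms isomorphism_bij unfolding symplectic_isomorphism_iff by auto
  obtain u v where uv: "C u = a" "C v = b"
    using C(1) by (metis bij_pointE)
  show ?thesis
  proof (rule that[of "C u v"])
    fix k assume "1 + k * C u v \<noteq> 0"
    then have "symplectically_equivalent C (C + wedge (C (k *\<^sub>R u)) (C v))"
      by (intro wedge_perturbation_equivalent C(2)) (simp add: blinfun.bilinear_simps)
    then show "symplectically_equivalent (C + k *\<^sub>R wedge a b) C"
      by (metis symplectically_equivalent_sym blinfun.scaleR_right uv wedge_scaleR)
  qed
qed

text \<open>Adding the wedges one by one may meet a singular operator although both ends are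
  symplectic; splitting each wedge steers around it. The induction therefore varies C.\<close>

lemma wedge_sums_equivalent:
  fixes C :: "'a::real_normed_vector \<Rightarrow>\<^sub>L 'a dual"
  assumes "f \<in> wedge_sums" "symplectic_isomorphism C" "symplectic_isomorphism (C + f)"
  shows "symplectically_equivalent C (C + f)"
  using assms
proof (induction f arbitrary: C rule: wedge_sums_induct)
  case zero
  have "isomorphism_between (id_blinfun :: 'a \<Rightarrow>\<^sub>L 'a) UNIV UNIV"
    unfolding isomorphism_iff_inverse by (rule exI[of _ id_blinfun]) (auto intro!: blinfun_eqI)
  then show ?case
    unfolding symplectically_equivalent_iff by (intro exI[of _ id_blinfun]) simp
next
  case (add a b f)
  let ?g = "wedge a b" and ?D = "C + (wedge a b + f)"
  obtain m where m: "\<And>k. 1 + k * m \<noteq> 0 \<Longrightarrow> symplectically_equivalent (C + k *\<^sub>R ?g) C"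
    using wedge_perturbation_generic[OF add.prems(1)] by blast
  obtain m' where m': "\<And>k. 1 + k * m' \<noteq> 0 \<Longrightarrow> symplectically_equivalent (?D + k *\<^sub>R ?g) ?D"
    using wedge_perturbation_generic[OF add.prems(2)] by blast
  obtain k where k: "1 + k * m \<noteq> 0" "1 + (k - 1) * m' \<noteq> 0"
    using exists_avoiding_parameter by blast
  have "?D + (k - 1) *\<^sub>R ?g = (C + k *\<^sub>R ?g) + f"
    by (simp add: algebra_simps)
  then have D: "symplectically_equivalent ((C + k *\<^sub>R ?g) + f) ?D"
    using m'[OF k(2)] by metis
  have "symplectically_equivalent (C + k *\<^sub>R ?g) ((C + k *\<^sub>R ?g) + f)"
    using symplectic_isomorphism_equivalent[OF m[OF k(1)] add.prems(1)]
      symplectic_isomorphism_equivalent[OF D add.prems(2)] by (rule add.IH)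
  then show ?case
    using symplectically_equivalent_sym[OF m[OF k(1)]] D symplectically_equivalent_trans by blast
qed

section \<open>Parity\<close>

definition lift_fst ::
  "('a::real_normed_vector \<Rightarrow>\<^sub>L 'a dual) \<Rightarrow> ('a \<times> 'b::real_normed_vector) \<Rightarrow>\<^sub>L ('a \<times> 'b) dual" where
  "lift_fst D = adjoint_blinfun fst_blinfun o\<^sub>L D o\<^sub>L fst_blinfun"

lemma lift_fst_apply [simp]: "lift_fst D p q = D (fst p) (fst q)"
  unfolding lift_fst_def by simp

lemma lift_fst_add: "lift_fst (C + D) = lift_fst C + lift_fst D"
  and lift_fst_scaleR: "lift_fst (k *\<^sub>R D) = k *\<^sub>R lift_fst D"
  by (intro blinfun_eqI; simp add: blinfun.bilinear_simps)+

lemma lift_fst_wedge: "lift_fst (wedge a b) = wedge (a o\<^sub>L fst_blinfun) (b o\<^sub>L fst_blinfun)"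
  by (intro blinfun_eqI) simp

lemma lift_fst_wedge_sums:
  assumes "f \<in> wedge_sums"
  shows "lift_fst f \<in> wedge_sums"
  using assms
proof (induction rule: wedge_sums_induct)
  case zero
  have "lift_fst 0 = 0"
    by (intro blinfun_eqI) simp
  then show ?case
    using wedge_sums_0 by metis
next
  case (add a b f)
  then show ?case
    unfolding lift_fst_add lift_fst_wedge by (intro wedge_sums_add wedge_in_wedge_sums)
qed

text \<open>The block form with D, border \<phi> of opposite signs, and corner 0. If D has a
  one-dimensional kernel spanned by e and \<phi> e = 1, the new vector (0, 1) pairs with e.\<close>

definition bordered ::
  "('a::real_normed_vector \<Rightarrow>\<^sub>L 'a dual) \<Rightarrow> 'a dual \<Rightarrow> ('a \<times> real) \<Rightarrow>\<^sub>L ('a \<times> real) dual" where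
  "bordered D \<phi> = lift_fst D + wedge snd_blinfun (\<phi> o\<^sub>L fst_blinfun)"

lemma bordered_apply:
  "bordered D \<phi> p q = D (fst p) (fst q) + (snd p * \<phi> (fst q) - \<phi> (fst p) * snd q)"
  unfolding bordered_def by (simp add: blinfun.add_left)

lemma skew_bordered:
  assumes "skew D"
  shows "skew (bordered D \<phi>)"
proof -
  have "skew (lift_fst D)"
    using skewD[OF assms] unfolding skew_def by (metis lift_fst_apply)
  then show ?thesis
    unfolding bordered_def by (intro skew_add skew_wedge)
qed

text \<open>Infinite-dimensional form of the fact that there is no symplectic form in odd dimension.\<close>

lemma bordered_not_symplectic:
  fixes C :: "'a::real_normed_vector \<Rightarrow>\<^sub>L 'a dual"
  assumes "f \<in> wedge_sums" "symplectic_isomorphism C"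
  shows "\<not> symplectic_isomorphism (bordered (C + f) \<phi>)"
  using assms
proof (induction f arbitrary: C rule: wedge_sums_induct)
  case zero
  then have C: "bij C" "skew C"
    using isomorphism_bij unfolding symplectic_isomorphism_iff by auto
  obtain w where w: "C w = \<phi>"
    using C(1) by (metis bij_pointE)
  \<comment> \<open>The X-component cancels as C w = \<phi>, and the last component is a multiple of
    C w w = 0.\<close>
  have "bordered C \<phi> (w, - 1) = bordered C \<phi> 0"
    by (intro blinfun_eqI) (simp add: bordered_apply w flip: w, simp add: skew_self[OF C(2)])
  then have "\<not> inj (bordered C \<phi>)"
    by (metis injD prod.inject zero_prod_def neg_equal_0_iff_equal one_neq_zero)
  then show ?case
    using isomorphism_bij[of "bordered C \<phi>"] unfolding symplectic_isomorphism_iff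
    by (auto simp: bij_def)
next
  case (add a b f)
  let ?g = "wedge a b" and ?B = "bordered (C + (wedge a b + f)) \<phi>"
  show ?case
  proof
    assume B: "symplectic_isomorphism ?B"
    obtain m where m: "\<And>k. 1 + k * m \<noteq> 0 \<Longrightarrow> symplectically_equivalent (C + k *\<^sub>R ?g) C"
      using wedge_perturbation_generic[OF add.prems(1)] by blast
    \<comment> \<open>A lifted wedge is a wedge on the larger space, so the same genericity applies
      to the bordered operator.\<close>
    obtain m' where m': "\<And>k. 1 + k * m' \<noteq> 0 \<Longrightarrow>
        symplectically_equivalent (?B + k *\<^sub>R lift_fst ?g) ?B"
      unfolding lift_fst_wedge using wedge_perturbation_generic[OF B] by blast
    obtain k where k: "1 + k * m \<noteq> 0" "1 + (k - 1) * m' \<noteq> 0"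
      using exists_avoiding_parameter by blast
    have "?B + (k - 1) *\<^sub>R lift_fst ?g = bordered ((C + k *\<^sub>R ?g) + f) \<phi>"
      unfolding bordered_def lift_fst_add lift_fst_scaleR by (simp add: algebra_simps)
    then have "symplectic_isomorphism (bordered ((C + k *\<^sub>R ?g) + f) \<phi>)"
      using symplectic_isomorphism_equivalent[OF m'[OF k(2)] B] by metis
    then show False
      using add.IH symplectic_isomorphism_equivalent[OF m[OF k(1)] add.prems(1)] by blast
  qed
qed

text \<open>A lower bound would already make the bordered operator symplectic: it differs by finite
  rank from a bijection, hence is surjective as soon as it is injective.\<close>

lemma bordered_not_bounded_below:
  fixes C :: "'a::real_normed_vector \<Rightarrow>\<^sub>L 'a dual"
  assumes C: "symplectic_isomorphism C" and f: "f \<in> wedge_sums"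
  shows "\<not> bounded_below_on UNIV (bordered (C + f) \<phi>)"
proof
  let ?B = "bordered (C + f) \<phi>"
  assume B: "bounded_below_on UNIV ?B"
  have "bij C" and "skew C"
    using C isomorphism_bij unfolding symplectic_isomorphism_iff by auto
  let ?s = "snd_blinfun :: ('a \<times> real) \<Rightarrow>\<^sub>L real"
  \<comment> \<open>The comparison bijection puts the symmetric product on the extra line; it is not
    skew, but only bijectivity is wanted.\<close>
  define E :: "('a \<times> real) \<Rightarrow>\<^sub>L ('a \<times> real) dual" where "E = lift_fst C + rank_one ?s ?s"
  have E: "E p q = C (fst p) (fst q) + snd p * snd q" for p q
    unfolding E_def by (simp add: blinfun.bilinear_simps)
  have "bij E"
  proof (rule bijI)
    have "p = 0" if "E p = 0" for p
    proof -
      have "C (fst p) = 0"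
        using E[of p "(_, 0)"] that by (intro blinfun_eqI) simp
      moreover have "snd p = 0"
        using E[of p "(0, 1)"] that by simp
      ultimately show ?thesis
        using \<open>bij C\<close> by (metis bij_def blinfun.zero_right injD prod.collapse zero_prod_def)
    qed
    then show "inj E"
      by (rule blinfun_injI)
    show "surj E"
      unfolding surj_def
    proof
      fix \<psi> :: "('a \<times> real) dual"
      have "bounded_linear (\<lambda>y. \<psi> (y, 0))"
        by (intro bounded_linear_intros)
      then obtain x where x: "C x = Blinfun (\<lambda>y. \<psi> (y, 0))"
        "\<And>y. Blinfun (\<lambda>y. \<psi> (y, 0)) y = \<psi> (y, 0)"
        using \<open>bij C\<close> by (metis bij_pointE bounded_linear_Blinfun_apply)
      have "\<psi> q = E (x, \<psi> (0, 1)) q" for q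
      proof -
        have "q = (fst q, 0) + snd q *\<^sub>R (0, 1)"
          by (simp add: prod_eq_iff)
        then have "\<psi> q = \<psi> (fst q, 0) + snd q * \<psi> (0, 1)"
          by (metis blinfun.add_right blinfun.scaleR_right real_scaleR_def)
        then show ?thesis
          by (simp add: E x)
      qed
      then show "\<exists>p. \<psi> = E p"
        by (metis blinfun_eqI)
    qed
  qed
  have dec: "?B = E + (lift_fst f + wedge ?s (\<phi> o\<^sub>L fst_blinfun) + rank_one (- ?s) ?s)"
    by (intro blinfun_eqI) (simp add: bordered_apply E blinfun.bilinear_simps)
  have "lift_fst f + wedge ?s (\<phi> o\<^sub>L fst_blinfun) + rank_one (- ?s) ?s \<in> finite_rank"
    by (intro finite_rank_add rank_one_finite_rank wedge_sums_finite_rank lift_fst_wedge_sums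
        wedge_in_wedge_sums f)
  moreover have "inj ?B"
    using bounded_below_on_injD[OF B UNIV_I] by (rule blinfun_injI)
  ultimately have "surj ?B"
    unfolding dec using \<open>bij E\<close> by (intro finite_rank_inj_imp_surj)
  then have "symplectic_isomorphism ?B"
    using B \<open>skew C\<close> f unfolding symplectic_isomorphism_iff isomorphism_iff_bounded_below
    by (blast intro: skew_bordered skew_add wedge_sums_skew)
  then show False
    using bordered_not_symplectic[OF f C] by blast
qed

section \<open>Strictly singular perturbations\<close>

definition common_kernel :: "'a::real_normed_vector dual set \<Rightarrow> 'a set" where
  "common_kernel \<Phi> = {x. \<forall>\<phi>\<in>\<Phi>. \<phi> x = 0}"

lemma common_kernel_empty [simp]: "common_kernel {} = UNIV"
  unfolding common_kernel_def by simp

lemma common_kernel_insert: "common_kernel (insert \<phi> \<Phi>) = {x \<in> common_kernel \<Phi>. \<phi> x = 0}"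
  unfolding common_kernel_def by blast

lemma subspace_kernel_restrict:
  fixes \<phi> :: "'a::real_normed_vector dual"
  assumes "subspace N"
  shows "subspace {x \<in> N. \<phi> x = 0}"
  using assms unfolding subspace_def by (simp add: blinfun.bilinear_simps)

lemma closed_kernel_restrict:
  fixes \<phi> :: "'a::real_normed_vector dual"
  assumes "closed N"
  shows "closed {x \<in> N. \<phi> x = 0}"
proof -
  have "{x \<in> N. \<phi> x = 0} = N \<inter> {x. \<phi> x = 0}" by blast
  then show ?thesis
    by (simp add: assms closed_Int closed_Collect_eq continuous_intros)
qed

lemma subspace_common_kernel: "subspace (common_kernel \<Phi>)"
  unfolding common_kernel_def subspace_def by (simp add: blinfun.bilinear_simps)

lemma closed_common_kernel: "closed (common_kernel \<Phi>)"
proof -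
  have "common_kernel \<Phi> = (\<Inter>\<phi>\<in>\<Phi>. {x. blinfun_apply \<phi> x = 0})"
    unfolding common_kernel_def by blast
  then show ?thesis
    by (simp add: closed_INT closed_Collect_eq continuous_intros)
qed

lemma subspace_closure:
  fixes S :: "'a::real_normed_vector set"
  assumes "subspace S"
  shows "subspace (closure S)"
  unfolding subspace_def
proof (intro conjI ballI allI)
  show "0 \<in> closure S"
    using assms closure_subset subspace_0 by blast
next
  fix x y assume "x \<in> closure S" "y \<in> closure S"
  then obtain f g where "\<And>n. f n \<in> S" "\<And>n. g n \<in> S" "f \<longlonglongrightarrow> x" "g \<longlonglongrightarrow> y"
    unfolding closure_sequential by blast
  then have "\<forall>n. f n + g n \<in> S" "(\<lambda>n. f n + g n) \<longlonglongrightarrow> x + y"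
    using assms by (auto intro: subspace_add tendsto_add)
  then show "x + y \<in> closure S"
    unfolding closure_sequential by (intro exI[of _ "\<lambda>n. f n + g n"]) simp
next
  fix c x assume "x \<in> closure S"
  then obtain f where "\<And>n. f n \<in> S" "f \<longlonglongrightarrow> x"
    unfolding closure_sequential by blast
  then have "\<forall>n. c *\<^sub>R f n \<in> S" "(\<lambda>n. c *\<^sub>R f n) \<longlonglongrightarrow> c *\<^sub>R x"
    using assms by (auto intro: subspace_scale tendsto_intros)
  then show "c *\<^sub>R x \<in> closure S"
    unfolding closure_sequential by (intro exI[of _ "\<lambda>n. c *\<^sub>R f n"]) simp
qed

text \<open>The coefficient functionals of a sequence that is triangular with respect to almost
  norming functionals grow at most geometrically, so that prescribing fast decay of the operator
  on the sequence makes it small on the whole span.\<close>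

lemma triangular_coefficient_bound:
  fixes x :: "nat \<Rightarrow> 'a::real_normed_vector" and \<phi> :: "nat \<Rightarrow> 'a dual"
  assumes x: "\<And>n. norm (x n) = 1" "\<And>n. \<phi> n (x n) = 1" "\<And>i n. i < n \<Longrightarrow> \<phi> i (x n) = 0"
    and K: "K \<ge> 0" "\<And>n. norm (\<phi> n) \<le> K"
    and y: "y = (\<Sum>i<m. a i *\<^sub>R x i)" and k: "k < m"
  shows "\<bar>a k\<bar> \<le> K * (1 + K) ^ k * norm y"
  using k
proof (induction k rule: less_induct)
  case (less k)
  \<comment> \<open>This identity solves the recursion |a k| \<le> K |y| + K (|a 0| + ... + |a (k -
    1)|) and is the origin of the bound.\<close>
  have geometric: "1 + (\<Sum>i<n. K * (1 + K) ^ i) = (1 + K) ^ n" for n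
    by (induction n) (simp_all add: algebra_simps)
  have bound: "\<bar>\<phi> k z\<bar> \<le> K * norm z" for z
    using norm_blinfun[of "\<phi> k" z] mult_right_mono[OF K(2)[of k], of "norm z"] by simp
  have "\<phi> k y = (\<Sum>i<m. a i * \<phi> k (x i))"
    unfolding y by (simp add: blinfun.sum_right blinfun.scaleR_right)
  also have "\<dots> = (\<Sum>i<Suc k. a i * \<phi> k (x i))"
    using less.prems x(3) by (intro sum.mono_neutral_right) auto
  also have "\<dots> = (\<Sum>i<k. a i * \<phi> k (x i)) + a k"
    by (simp add: x(2))
  finally have "\<bar>a k\<bar> \<le> \<bar>\<phi> k y\<bar> + \<bar>\<Sum>i<k. a i * \<phi> k (x i)\<bar>"
    by simp
  also have "\<bar>\<phi> k y\<bar> \<le> K * norm y"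
    by (rule bound)
  also have "\<bar>\<Sum>i<k. a i * \<phi> k (x i)\<bar> \<le> (\<Sum>i<k. (K * (1 + K) ^ i * norm y) * K)"
  proof (intro order_trans[OF sum_abs] sum_mono)
    fix i assume "i \<in> {..<k}"
    then have "\<bar>a i\<bar> \<le> K * (1 + K) ^ i * norm y"
      using less by simp
    then show "\<bar>a i * \<phi> k (x i)\<bar> \<le> (K * (1 + K) ^ i * norm y) * K"
      unfolding abs_mult using bound[of "x i"] x(1)[of i] K(1) by (intro mult_mono) auto
  qed
  also have "K * norm y + (\<Sum>i<k. (K * (1 + K) ^ i * norm y) * K) =
      K * norm y * (1 + (\<Sum>i<k. K * (1 + K) ^ i))"
    by (simp add: sum_distrib_left algebra_simps)
  also have "\<dots> = K * (1 + K) ^ k * norm y"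
    unfolding geometric by simp
  finally show ?case by simp
qed

lemma span_range_eq_partial_sum:
  fixes x :: "nat \<Rightarrow> 'a::real_vector"
  assumes "y \<in> span (range x)"
  shows "\<exists>m a. y = (\<Sum>i<m. a i *\<^sub>R x i)"
proof -
  \<comment> \<open>Asking for all large n lets two sums be brought to a common length.\<close>
  have "\<exists>m a. \<forall>n\<ge>m. y = (\<Sum>i<n. a i *\<^sub>R x i)"
    using assms
  proof (induction rule: span_induct_alt)
    case base
    then show ?case by (intro exI[of _ 0] exI[of _ "\<lambda>_. 0"]) simp
  next
    case (step c z y)
    then obtain j m a where j: "z = x j" and a: "\<And>n. n \<ge> m \<Longrightarrow> y = (\<Sum>i<n. a i *\<^sub>R x i)"
      by blast
    have "c *\<^sub>R z + y = (\<Sum>i<n. (a i + (if i = j then c else 0)) *\<^sub>R x i)" if "n \<ge> max m (Suc j)" for n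
    proof -
      have "(\<Sum>i<n. (if i = j then c else 0) *\<^sub>R x i) = (\<Sum>i<n. if i = j then c *\<^sub>R x i else 0)"
        by (intro sum.cong) auto
      also have "\<dots> = c *\<^sub>R z"
        using that by (simp add: j)
      finally show ?thesis
        using that a[of n] by (simp add: scaleR_add_left sum.distrib)
    qed
    then show ?case
      by (intro exI[of _ "max m (Suc j)"] exI[of _ "\<lambda>i. a i + (if i = j then c else 0)"]) blast
  qed
  then show ?thesis by blast
qed

text \<open>Otherwise one picks unit vectors, each killed by the earlier functionals, on which A =
  \<alpha> + t s is tiny. On their closed span A has norm at most c / 2 while \<alpha> is bounded
  below by c, so t s is bounded below on an infinite-dimensional subspace.\<close>

lemma strictly_singular_perturbation_bounded_below:
  fixes \<alpha> s :: "'a::real_normed_vector \<Rightarrow>\<^sub>L 'b::real_normed_vector"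
  assumes s: "strictly_singular s"
    and c: "c > 0" "\<And>x. c * norm x \<le> norm (\<alpha> x)"
    and K: "K \<ge> 0" "\<And>x. norm x = 1 \<Longrightarrow> \<exists>\<phi> :: 'a dual. blinfun_apply \<phi> x = 1 \<and> norm \<phi> \<le> K"
  shows "\<exists>\<Phi>. finite \<Phi> \<and> bounded_below_on (common_kernel \<Phi>) (\<alpha> + t *\<^sub>R s)"
proof (rule ccontr)
  assume no: "\<not> ?thesis"
  define A where "A = \<alpha> + t *\<^sub>R s"
  have "\<exists>x (\<phi> :: 'a dual). x \<in> common_kernel \<Phi> \<and> norm x = 1 \<and> norm (A x) \<le> \<delta> \<and>
      blinfun_apply \<phi> x = 1 \<and> norm \<phi> \<le> K"
    if fin: "finite \<Phi>" and pos: "\<delta> > 0" for \<Phi> :: "'a dual set" and \<delta>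
  proof -
    have "\<not> bounded_below_on (common_kernel \<Phi>) A"
      using no fin unfolding A_def by blast
    then obtain z where z: "z \<in> common_kernel \<Phi>" "norm (A z) < \<delta> * norm z"
      using pos unfolding bounded_below_on_def by (meson not_le)
    then have "z \<noteq> 0" by auto
    define x where "x = (1 / norm z) *\<^sub>R z"
    have "x \<in> common_kernel \<Phi>"
      unfolding x_def using z(1) subspace_common_kernel subspace_scale by blast
    moreover have x1: "norm x = 1"
      unfolding x_def using \<open>z \<noteq> 0\<close> by simp
    moreover have "norm (A x) \<le> \<delta>"
      unfolding x_def using z(2) \<open>z \<noteq> 0\<close> by (simp add: blinfun.scaleR_right field_simps)
    ultimately show ?thesis
      using K(2)[OF x1] by blast
  qed
  then obtain X F where XF: "\<And>\<Phi> \<delta>. finite \<Phi> \<Longrightarrow> \<delta> > 0 \<Longrightarrow>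
      X \<Phi> \<delta> \<in> common_kernel \<Phi> \<and> norm (X \<Phi> \<delta>) = 1 \<and> norm (A (X \<Phi> \<delta>)) \<le> \<delta> \<and>
      blinfun_apply (F \<Phi> \<delta> :: 'a dual) (X \<Phi> \<delta>) = 1 \<and> norm (F \<Phi> \<delta>) \<le> K"
    by metis
  \<comment> \<open>Cancels the growth of the i-th coefficient and leaves c / 4 times 1 / 2^i, with
    total at most c / 2. The factor 1 + K keeps the quotient defined for K = 0.\<close>
  define \<delta> where "\<delta> n = (c / 4) * (1 / 2) ^ n / ((1 + K) * (1 + K) ^ n)" for n :: nat
  have \<delta>_pos: "\<delta> n > 0" for n
    unfolding \<delta>_def using c(1) K(1) by simp
  \<comment> \<open>S n collects the functionals chosen before stage n; x n is taken in their common
    kernel.\<close>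
  define S where "S = rec_nat {} (\<lambda>n S. insert (F S (\<delta> n)) S)"
  define x where "x n = X (S n) (\<delta> n)" for n
  define \<phi> where "\<phi> n = F (S n) (\<delta> n)" for n
  have S_Suc: "S (Suc n) = insert (\<phi> n) (S n)" for n
    unfolding S_def \<phi>_def by simp
  have fin: "finite (S n)" for n
    by (induction n) (simp_all add: S_Suc, simp add: S_def)
  have mem: "\<phi> i \<in> S n" if "i < n" for i n
    using that by (induction n) (auto simp: S_Suc less_Suc_eq)
  have x: "norm (x n) = 1" "\<phi> n (x n) = 1" "norm (\<phi> n) \<le> K" "norm (A (x n)) \<le> \<delta> n" for n
    using XF[OF fin \<delta>_pos] unfolding x_def \<phi>_def by blast+
  have tri: "\<phi> i (x n) = 0" if "i < n" for i n
    using XF[OF fin \<delta>_pos, of n n] mem[OF that] unfolding x_def common_kernel_def by blast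
  have small: "norm (A y) \<le> (c / 2) * norm y" if y_span: "y \<in> span (range x)" for y
  proof -
    obtain m a where y: "y = (\<Sum>i<m. a i *\<^sub>R x i)"
      using span_range_eq_partial_sum[OF y_span] by blast
    have "norm (A y) \<le> (\<Sum>i<m. \<bar>a i\<bar> * norm (A (x i)))"
      unfolding y by (simp add: blinfun.sum_right blinfun.scaleR_right order_trans[OF norm_sum])
    also have "\<dots> \<le> (\<Sum>i<m. ((c / 4) * (1 / 2) ^ i) * norm y)"
    proof (rule sum_mono)
      fix i assume "i \<in> {..<m}"
      then have "\<bar>a i\<bar> \<le> K * (1 + K) ^ i * norm y"
        using triangular_coefficient_bound[OF x(1) x(2) tri K(1) x(3) y] by simp
      also have "\<dots> \<le> (1 + K) * (1 + K) ^ i * norm y"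
        using K(1) by (intro mult_right_mono) auto
      finally have "\<bar>a i\<bar> * norm (A (x i)) \<le> ((1 + K) * (1 + K) ^ i * norm y) * \<delta> i"
        using x(4)[of i] K(1) by (intro mult_mono) auto
      also have "\<dots> = ((c / 4) * (1 / 2) ^ i) * norm y"
        unfolding \<delta>_def using K(1) by simp
      finally show "\<bar>a i\<bar> * norm (A (x i)) \<le> ((c / 4) * (1 / 2) ^ i) * norm y" .
    qed
    also have "\<dots> = (c / 4) * (\<Sum>i<m. (1 / 2) ^ i) * norm y"
      by (simp add: sum_distrib_left sum_distrib_right)
    also have "\<dots> \<le> (c / 4) * 2 * norm y"
    proof (intro mult_right_mono mult_left_mono)
      have "(\<Sum>i<m. (1 / 2 :: real) ^ i) = 2 - 2 * (1 / 2) ^ m"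
        by (induction m) simp_all
      then show "(\<Sum>i<m. (1 / 2 :: real) ^ i) \<le> 2" by simp
    qed (use c(1) in auto)
    finally show ?thesis by simp
  qed
  define M where "M = closure (span (range x))"
  have "span (range x) \<subseteq> {y. (c / 2) * norm y \<le> \<bar>t\<bar> * norm (s y)}"
  proof
    fix y assume "y \<in> span (range x)"
    have "\<alpha> y = A y - t *\<^sub>R s y"
      unfolding A_def by (simp add: blinfun.bilinear_simps)
    then have "norm (\<alpha> y) \<le> norm (A y) + \<bar>t\<bar> * norm (s y)"
      using norm_triangle_ineq4[of "A y" "t *\<^sub>R s y"] by simp
    then show "y \<in> {y. (c / 2) * norm y \<le> \<bar>t\<bar> * norm (s y)}"
      using c(2)[of y] small[OF \<open>y \<in> span (range x)\<close>] by simp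
  qed
  moreover have "closed {y. (c / 2) * norm y \<le> \<bar>t\<bar> * norm (s y)}"
    by (intro closed_Collect_le continuous_intros)
  ultimately have "M \<subseteq> {y. (c / 2) * norm y \<le> \<bar>t\<bar> * norm (s y)}"
    unfolding M_def by (rule closure_minimal)
  then have M: "(c / 2) * norm y \<le> \<bar>t\<bar> * norm (s y)" if "y \<in> M" for y
    using that by blast
  have x_in_M: "x n \<in> M" for n
    unfolding M_def using closure_subset[of "span (range x)"] span_base[of "x n" "range x"] by blast
  have "t \<noteq> 0"
    using M[OF x_in_M[of 0]] x(1)[of 0] c(1) by auto
  then have "c / (2 * \<bar>t\<bar>) * norm y \<le> norm (s y)" if "y \<in> M" for y
    using M[OF that] by (simp add: field_simps)
  then have "bounded_below_on M s"
    unfolding bounded_below_on_def using c(1) \<open>t \<noteq> 0\<close> by (intro exI[of _ "c / (2 * \<bar>t\<bar>)"]) auto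
  moreover have "subspace M" "closed M"
    unfolding M_def by (auto intro: subspace_closure subspace_span)
  moreover have "\<not> (\<exists>B. finite B \<and> span B = M)"
  proof
    assume "\<exists>B. finite B \<and> span B = M"
    then obtain B where B: "finite B" "span B = M" by blast
    \<comment> \<open>The first vector is split off, since \<phi> n kills all later ones but not x
      n; hence the start n is general.\<close>
    have indep: "independent (x ` {n..<n + k})" for n k
    proof (induction k arbitrary: n)
      case 0
      show ?case by (simp add: independent_empty)
    next
      case (Suc k)
      have "span (x ` {Suc n..<Suc n + k}) \<subseteq> {y. \<phi> n y = 0}"
        using tri by (intro span_minimal) (auto simp: subspace_def blinfun.bilinear_simps)
      then have "x n \<notin> span (x ` {Suc n..<Suc n + k})"
        using x(2)[of n] by auto
      moreover have "{n..<n + Suc k} = insert n {Suc n..<Suc n + k}"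
        by auto
      ultimately show ?case
        using Suc.IH[of "Suc n"] by (simp add: independent_insertI)
    qed
    have "inj x"
      by (rule linorder_injI) (metis x(2) tri zero_neq_one)
    have "card (x ` {0..<0 + Suc (card B)}) \<le> card B"
      using independent_span_bound[OF B(1) indep] B(2) x_in_M by (metis image_subsetI)
    then show False
      by (simp add: card_image[OF inj_on_subset[OF \<open>inj x\<close> subset_UNIV]])
  qed
  ultimately show False
    using s bounded_below_imp_isomorphism_between unfolding strictly_singular_def by blast
qed

text \<open>The form itself replaces Hahn-Banach. Since \<open>norm (C x)\<close> exceeds c / 2,
  some y has |C x y| > (c / 2) |y|, and the functional C y, normalised at x, does the job by
  skewness.\<close>

lemma skew_norming:
  fixes C :: "'a::real_normed_vector \<Rightarrow>\<^sub>L 'a dual"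
  assumes "skew C" and c: "c > 0" "\<And>x. c * norm x \<le> norm (C x)" and "norm x = 1"
  shows "\<exists>\<phi> :: 'a dual. blinfun_apply \<phi> x = 1 \<and> norm \<phi> \<le> 2 * norm C / c"
proof -
  have "\<not> norm (C x) \<le> c / 2"
    using c(2)[of x] c(1) assms(4) by simp
  then obtain y where y: "\<not> norm (C x y) \<le> (c / 2) * norm y"
    using norm_blinfun_bound[of "c / 2" "C x"] c(1) by auto
  have sk: "C y x = - C x y"
    using assms(1) by (rule skewD)
  then have "C y x \<noteq> 0"
    using y c(1) by auto
  have "norm (C y) \<le> norm C * norm y"
    by (rule norm_blinfun)
  also have "\<dots> \<le> norm C * (2 / c * \<bar>C y x\<bar>)"
    using y c(1) sk by (intro mult_left_mono) (auto simp: field_simps)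
  finally have "norm ((1 / C y x) *\<^sub>R C y) \<le> 2 * norm C / c"
    using \<open>C y x \<noteq> 0\<close> c(1) by (simp add: field_simps)
  moreover have "((1 / C y x) *\<^sub>R C y) x = 1"
    using \<open>C y x \<noteq> 0\<close> by (simp add: blinfun.scaleR_left)
  ultimately show ?thesis by blast
qed

section \<open>Reduction to an injective operator\<close>

text \<open>Only one scalar needs compactness: along a subsequence of unit vectors with A (x n)
  tending to 0, the values \<phi> (x n) converge, and the components in the kernel of \<phi> are
  Cauchy by the lower bound. The limit is a unit vector killed by A.\<close>

lemma bounded_below_on_extend:
  fixes A :: "'a::banach \<Rightarrow>\<^sub>L 'b::real_normed_vector" and \<phi> :: "'a dual"
  assumes N: "subspace N" "closed N"
    and A: "bounded_below_on {x \<in> N. \<phi> x = 0} A"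
    and inj: "\<And>x. x \<in> N \<Longrightarrow> A x = 0 \<Longrightarrow> x = 0"
  shows "bounded_below_on N A"
proof (rule ccontr)
  assume no: "\<not> bounded_below_on N A"
  obtain c where c: "c > 0" "\<And>x. x \<in> N \<Longrightarrow> \<phi> x = 0 \<Longrightarrow> c * norm x \<le> norm (A x)"
    using A unfolding bounded_below_on_def by auto
  have "\<exists>v\<in>N. \<phi> v \<noteq> 0"
    using no A by (metis (mono_tags, lifting) bounded_below_on_mono mem_Collect_eq subsetI)
  then obtain v0 where "v0 \<in> N" "\<phi> v0 \<noteq> 0" by blast
  define v where "v = (1 / \<phi> v0) *\<^sub>R v0"
  have v: "v \<in> N" "\<phi> v = 1"
    unfolding v_def using \<open>v0 \<in> N\<close> \<open>\<phi> v0 \<noteq> 0\<close> N(1)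
    by (auto intro: subspace_scale simp: blinfun.scaleR_right)
  have "\<exists>x\<in>N. norm x = 1 \<and> norm (A x) \<le> 1 / real (Suc n)" for n
  proof -
    obtain z where z: "z \<in> N" "norm (A z) < 1 / real (Suc n) * norm z"
      using no unfolding bounded_below_on_def 
      by (metis not_le of_nat_0_less_iff zero_less_Suc zero_less_divide_1_iff)
    then have "z \<noteq> 0" by auto
    then have "norm ((1 / norm z) *\<^sub>R z) = 1" "norm (A ((1 / norm z) *\<^sub>R z)) \<le> 1 / real (Suc n)"
      using z(2) by (simp_all add: blinfun.scaleR_right field_simps)
    then show ?thesis
      using z(1) N(1) subspace_scale by blast
  qed
  then obtain x where x: "\<And>n. x n \<in> N" "\<And>n. norm (x n) = 1" "\<And>n. norm (A (x n)) \<le> 1 / real (Suc n)"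
    by metis
  have "(\<lambda>n. A (x n)) \<longlonglongrightarrow> 0"
    by (rule Lim_null_comparison[OF _ LIMSEQ_Suc[OF lim_1_over_n]]) (use x(3) in auto)
  have "\<bar>\<phi> (x n)\<bar> \<le> norm \<phi>" for n
    using norm_blinfun[of \<phi> "x n"] x(2)[of n] by simp
  then have "bounded (range (\<lambda>n. \<phi> (x n)))"
    unfolding bounded_iff by auto
  then obtain l r where r: "strict_mono r" "((\<lambda>n. \<phi> (x n)) \<circ> r) \<longlonglongrightarrow> l"
    using bounded_imp_convergent_subsequence by blast
  define y where "y n = x (r n) - \<phi> (x (r n)) *\<^sub>R v" for n
  have y: "y n \<in> N" "\<phi> (y n) = 0" for n
    unfolding y_def using x(1) v N(1)
    by (auto intro: subspace_diff subspace_scale simp: blinfun.bilinear_simps)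
  have \<phi>_lim: "(\<lambda>n. \<phi> (x (r n))) \<longlonglongrightarrow> l"
    using r(2) by (simp add: o_def)
  have Ax_lim: "(\<lambda>n. A (x (r n))) \<longlonglongrightarrow> 0"
    using LIMSEQ_subseq_LIMSEQ[OF \<open>(\<lambda>n. A (x n)) \<longlonglongrightarrow> 0\<close> r(1)] by (simp add: o_def)
  then have "(\<lambda>n. A (x (r n)) - \<phi> (x (r n)) *\<^sub>R A v) \<longlonglongrightarrow> 0 - l *\<^sub>R A v"
    by (intro tendsto_intros \<phi>_lim)
  then have "Cauchy (\<lambda>n. A (y n))"
    unfolding y_def blinfun.diff_right blinfun.scaleR_right by (rule LIMSEQ_imp_Cauchy)
  have "Cauchy y"
  proof (rule CauchyI)
    fix e :: real assume "e > 0"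
    then obtain n0 where n0: "\<And>m n. m \<ge> n0 \<Longrightarrow> n \<ge> n0 \<Longrightarrow> norm (A (y m) - A (y n)) < c * e"
      using CauchyD[OF \<open>Cauchy (\<lambda>n. A (y n))\<close>, of "c * e"] c(1) by auto
    have "norm (y m - y n) < e" if "m \<ge> n0" "n \<ge> n0" for m n
    proof -
      have "c * norm (y m - y n) \<le> norm (A (y m - y n))"
        using y N(1) by (intro c(2)) (auto intro: subspace_diff simp: blinfun.diff_right)
      also have "\<dots> < c * e"
        using n0[OF that] by (simp add: blinfun.diff_right)
      finally show ?thesis using c(1) by simp
    qed
    then show "\<exists>n0. \<forall>m\<ge>n0. \<forall>n\<ge>n0. norm (y m - y n) < e" by blast
  qed
  then obtain y' where y': "y \<longlonglongrightarrow> y'"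
    using Cauchy_convergent_iff convergent_def by blast
  then have "(\<lambda>n. y n + \<phi> (x (r n)) *\<^sub>R v) \<longlonglongrightarrow> y' + l *\<^sub>R v"
    by (intro tendsto_intros \<phi>_lim)
  then have lim: "(\<lambda>n. x (r n)) \<longlonglongrightarrow> y' + l *\<^sub>R v"
    unfolding y_def by simp
  have "y' + l *\<^sub>R v \<in> N"
    using closed_sequentially[OF N(2) _ lim] x(1) by blast
  moreover have "(\<lambda>n. A (x (r n))) \<longlonglongrightarrow> A (y' + l *\<^sub>R v)"
    by (intro tendsto_intros lim)
  then have "A (y' + l *\<^sub>R v) = 0"
    using Ax_lim LIMSEQ_unique by blast
  ultimately have "y' + l *\<^sub>R v = 0"
    by (rule inj)
  moreover have "norm (y' + l *\<^sub>R v) = 1"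
    using tendsto_norm[OF lim] by (simp add: x(2) LIMSEQ_const_iff)
  ultimately show False by simp
qed

text \<open>By skewness A x vanishes at the kernel vectors e and e'. Evaluating the sum there
  isolates \<phi> x and \<psi> x, so a vector killed by the sum lies where A is bounded
  below.\<close>

lemma bounded_below_on_add_wedge:
  fixes A :: "'a::banach \<Rightarrow>\<^sub>L 'a dual" and \<phi> \<psi> :: "'a dual"
  assumes "skew A" and N: "subspace N" "closed N"
    and e: "A e = 0" "\<phi> e = 0" "\<psi> e = 1"
    and e': "A e' = 0" "\<phi> e' = 1" "\<psi> e' = 0"
    and A: "bounded_below_on {x \<in> N. \<phi> x = 0 \<and> \<psi> x = 0} A"
  shows "bounded_below_on N (A + wedge \<phi> \<psi>)"
proof -
  let ?B = "A + wedge \<phi> \<psi>"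
  have B: "bounded_below_on {x \<in> {x \<in> N. \<phi> x = 0}. \<psi> x = 0} ?B"
    using A unfolding bounded_below_on_def by (simp add: blinfun.add_left wedge_apply1)
  have inj: "x = 0" if "x \<in> N" "?B x = 0" for x
  proof -
    have "A x e = 0" "A x e' = 0"
      using skewD[OF assms(1), of x] e(1) e'(1) by simp_all
    moreover have "?B x e = 0" "?B x e' = 0"
      using that(2) by simp_all
    ultimately have "\<phi> x = 0" "\<psi> x = 0"
      using e e' by (simp_all add: blinfun.add_left)
    then show ?thesis
      using bounded_below_on_injD[OF B _ that(2)] that(1) by blast
  qed
  have "bounded_below_on {x \<in> N. \<phi> x = 0} ?B"
    using B inj by (intro bounded_below_on_extend[OF subspace_kernel_restrict[OF N(1)]
          closed_kernel_restrict[OF N(2)]]) auto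
  then show ?thesis
    using inj by (rule bounded_below_on_extend[OF N])
qed

text \<open>The lift of A kills both (e, 0) and (0, 1), and the border is exactly the wedge that
  pairs them.\<close>

lemma bordered_bounded_below:
  fixes A :: "'a::banach \<Rightarrow>\<^sub>L 'a dual" and \<psi> :: "'a dual"
  assumes "skew A" "A e = 0" "\<psi> e = 1" and A: "bounded_below_on {x. \<psi> x = 0} A"
  shows "bounded_below_on UNIV (bordered A \<psi>)"
  unfolding bordered_def
proof (rule bounded_below_on_add_wedge[where e = "(e, 0 :: real)" and e' = "(0, 1 :: real)"])
  show "skew (lift_fst A :: ('a \<times> real) \<Rightarrow>\<^sub>L ('a \<times> real) dual)"
    unfolding skew_def using skewD[OF assms(1)] by (metis lift_fst_apply)
  show "lift_fst A (e, 0 :: real) = 0" "lift_fst A (0, 1 :: real) = 0"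
    by (intro blinfun_eqI; simp add: assms(2))+
  obtain c where c: "c > 0" "\<And>x. \<psi> x = 0 \<Longrightarrow> c * norm x \<le> norm (A x)"
    using A unfolding bounded_below_on_def by auto
  have "c * norm p \<le> norm (lift_fst A p)" if "snd p = 0" "\<psi> (fst p) = 0" for p :: "'a \<times> real"
  proof -
    have "c * norm p = c * norm (fst p)"
      using that(1) by (simp add: norm_prod_def)
    also have "\<dots> \<le> norm (A (fst p))"
      using that(2) by (rule c(2))
    also have "\<dots> \<le> norm (lift_fst A p)"
    proof (rule norm_blinfun_bound)
      show "norm (A (fst p) y) \<le> norm (lift_fst A p) * norm y" for y
        using norm_blinfun[of "lift_fst A p" "(y, 0)"] by (simp add: norm_prod_def)
    qed simp
    finally show ?thesis .
  qed
  then show "bounded_below_on {p \<in> UNIV. (snd_blinfun :: ('a \<times> real) \<Rightarrow>\<^sub>L real) p = 0 \<and>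
      (\<psi> o\<^sub>L fst_blinfun) p = 0} (lift_fst A)"
    unfolding bounded_below_on_def using c(1) by (intro exI[of _ c]) auto
qed (use assms(3) in auto)

text \<open>Functionals are dropped one at a time, with either no pending kernel vector or one, e,
  marked by \<psi>; these are the two halves of the induction statement. Dropping \<phi> may reveal
  a new kernel vector. It becomes pending, or is paired with e by
  \<open>wedge \<phi> \<psi>\<close>. A vector still pending at the end is handled by
  bordering.\<close>

lemma wedge_sums_reduction:
  fixes A :: "'a::banach \<Rightarrow>\<^sub>L 'a dual"
  assumes "finite \<Phi>" "skew A" "bounded_below_on (common_kernel \<Phi>) A"
  shows "\<exists>f\<in>wedge_sums. bounded_below_on UNIV (A + f) \<or>
    (\<exists>\<psi>. bounded_below_on UNIV (bordered (A + f) \<psi>))"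
proof -
  define good where "good A \<longleftrightarrow> (\<exists>f\<in>wedge_sums. bounded_below_on UNIV (A + f) \<or>
    (\<exists>\<psi>. bounded_below_on UNIV (bordered (A + f) \<psi>)))" for A :: "'a \<Rightarrow>\<^sub>L 'a dual"
  have good_wedge: "good A" if "good (A + wedge \<phi> \<psi>)" for A \<phi> \<psi>
    using that wedge_sums_add[OF wedge_in_wedge_sums[of \<phi> \<psi>]]
    unfolding good_def by (metis add.assoc)
  have kernel: "\<exists>e\<in>N. A e = 0 \<and> \<phi> e = 1"
    if N: "subspace N" "closed N" and A: "bounded_below_on {x \<in> N. \<phi> x = 0} A"
      and no: "\<not> bounded_below_on N A"
    for N :: "'a set" and A :: "'a \<Rightarrow>\<^sub>L 'a dual" and \<phi> :: "'a dual"
  proof -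
    obtain z where z: "z \<in> N" "A z = 0" "z \<noteq> 0"
      using bounded_below_on_extend[OF N A] no by blast
    then have "\<phi> z \<noteq> 0"
      using bounded_below_on_injD[OF A, of z] by blast
    then have "(1 / \<phi> z) *\<^sub>R z \<in> N" "A ((1 / \<phi> z) *\<^sub>R z) = 0" "\<phi> ((1 / \<phi> z) *\<^sub>R z) = 1"
      using z N(1) by (auto intro: subspace_scale simp: blinfun.scaleR_right)
    then show ?thesis by blast
  qed
  have "(\<forall>A. skew A \<longrightarrow> bounded_below_on (common_kernel \<Phi>) A \<longrightarrow> good A) \<and>
    (\<forall>A (\<psi> :: 'a dual) e. skew A \<longrightarrow> blinfun_apply A e = 0 \<longrightarrow> blinfun_apply \<psi> e = 1 \<longrightarrow> e \<in> common_kernel \<Phi> \<longrightarrow>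
      bounded_below_on {x \<in> common_kernel \<Phi>. blinfun_apply \<psi> x = 0} A \<longrightarrow> good A)"
    using assms(1)
  proof (induction rule: finite_induct)
    case empty
    have base: "good A" if "bounded_below_on UNIV A \<or> (\<exists>\<psi>. bounded_below_on UNIV (bordered A \<psi>))" for A
      using that wedge_sums_0 unfolding good_def by (metis add.right_neutral)
    show ?case
    proof (intro conjI allI impI)
      show "good A" if "bounded_below_on (common_kernel {}) A" for A
        using that base by simp
    next
      fix A :: "'a \<Rightarrow>\<^sub>L 'a dual" and \<psi> :: "'a dual" and e
      assume A: "skew A" "A e = 0" "\<psi> e = 1"
        and "bounded_below_on {x \<in> common_kernel {}. \<psi> x = 0} A"
      then have "bounded_below_on {x. \<psi> x = 0} A"
        by simp
      then show "good A"
        using base bordered_bounded_below[OF A] by blast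
    qed
  next
    case (insert \<phi> \<Phi>)
    let ?N = "common_kernel \<Phi>"
    note N = subspace_common_kernel[of \<Phi>] closed_common_kernel[of \<Phi>]
    have IH1: "good A" if "skew A" "bounded_below_on ?N A" for A
      using insert.IH that by blast
    have IH2: "good A" if "skew A" "A e = 0" "\<psi> e = 1" "e \<in> ?N"
      "bounded_below_on {x \<in> ?N. \<psi> x = 0} A" for A e and \<psi> :: "'a dual"
      using insert.IH that by blast
    show ?case
    proof (intro conjI allI impI)
      fix A :: "'a \<Rightarrow>\<^sub>L 'a dual"
      assume A: "skew A" "bounded_below_on (common_kernel (insert \<phi> \<Phi>)) A"
      note A2 = A(2)[unfolded common_kernel_insert]
      show "good A"
      proof (cases "bounded_below_on ?N A")
        case True
        with A(1) show ?thesis by (rule IH1)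
      next
        case False
        then obtain e where "e \<in> ?N" "A e = 0" "\<phi> e = 1"
          using kernel[OF N A2] by blast
        then show ?thesis
          using A(1) A2 IH2 by blast
      qed
    next
      fix A :: "'a \<Rightarrow>\<^sub>L 'a dual" and \<psi> :: "'a dual" and e
      assume A: "skew A" "A e = 0" "\<psi> e = 1" "e \<in> common_kernel (insert \<phi> \<Phi>)"
        and bb: "bounded_below_on {x \<in> common_kernel (insert \<phi> \<Phi>). \<psi> x = 0} A"
      have e: "e \<in> ?N" "\<phi> e = 0"
        using A(4) unfolding common_kernel_insert by auto
      let ?M = "{x \<in> ?N. \<psi> x = 0}"
      have M: "subspace ?M" "closed ?M"
        by (rule subspace_kernel_restrict[OF N(1)], rule closed_kernel_restrict[OF N(2)])
      have bb': "bounded_below_on {x \<in> ?M. \<phi> x = 0} A"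
        using bb by (rule bounded_below_on_mono) (auto simp: common_kernel_insert)
      show "good A"
      proof (cases "bounded_below_on ?M A")
        case True
        with A(1-3) e(1) show ?thesis by (rule IH2)
      next
        case False
        then obtain e' where e': "e' \<in> ?M" "A e' = 0" "\<phi> e' = 1"
          using kernel[OF M bb'] by blast
        have "bounded_below_on {x \<in> ?N. \<phi> x = 0 \<and> \<psi> x = 0} A"
          using bb' by (rule bounded_below_on_mono) auto
        then have "bounded_below_on ?N (A + wedge \<phi> \<psi>)"
          using A(2,3) e(2) e' by (intro bounded_below_on_add_wedge[OF A(1) N, of e _ _ e']) auto
        then have "good (A + wedge \<phi> \<psi>)"
          using A(1) by (intro IH1 skew_add skew_wedge)
        then show ?thesis by (rule good_wedge)
      qed
    qed
  qed
  then show ?thesis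
    using assms(2,3) unfolding good_def by blast
qed

section \<open>The homotopy argument\<close>

lemma bounded_below_perturb:
  fixes T R :: "'a::real_normed_vector \<Rightarrow>\<^sub>L 'b::real_normed_vector"
  assumes "\<And>x. c * norm x \<le> norm (T x)" "norm R \<le> c / 2"
  shows "(c / 2) * norm x \<le> norm ((T + R) x)"
proof -
  have "norm (R x) \<le> norm R * norm x"
    by (rule norm_blinfun)
  also have "\<dots> \<le> (c / 2) * norm x"
    using assms(2) by (intro mult_right_mono) auto
  finally show ?thesis
    using assms(1)[of x] norm_diff_ineq[of "T x" "R x"] by (simp add: blinfun.add_left)
qed

lemma exists_small_multiple:
  fixes c n :: real
  assumes "c > 0" "n \<ge> 0"
  shows "\<exists>\<delta>>0. \<delta> * n \<le> c"
proof -
  have "n + 1 > 0" using assms(2) by simp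
  then show ?thesis
    using assms(1) by (intro exI[of _ "c / (n + 1)"]) (simp add: field_simps)
qed

theorem proposition8p9:
  fixes \<alpha> s :: "'a::banach \<Rightarrow>\<^sub>L ('a \<Rightarrow>\<^sub>L real)"
  assumes "reflexive_space TYPE('a)"
    and "symplectic_isomorphism \<alpha>"
    and "strictly_singular s"
    and "symplectic_isomorphism (\<alpha> + s)"
  shows "symplectically_equivalent \<alpha> (\<alpha> + s)"
proof -
  have \<alpha>: "skew \<alpha>" "bounded_below_on UNIV \<alpha>"
    using assms(2) unfolding symplectic_isomorphism_iff isomorphism_iff_bounded_below by auto
  have "skew s"
    using skew_diff[of "\<alpha> + s" \<alpha>] assms(4) \<alpha>(1) unfolding symplectic_isomorphism_iff by simp
  obtain c0 where c0: "c0 > 0" "\<And>x. c0 * norm x \<le> norm (\<alpha> x)"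
    using \<alpha>(2) unfolding bounded_below_on_def by auto
  define G where "G = {t. \<exists>f\<in>wedge_sums. symplectic_isomorphism (\<alpha> + t *\<^sub>R s + f) \<and>
    symplectically_equivalent \<alpha> (\<alpha> + t *\<^sub>R s + f)}"
  \<comment> \<open>Nothing is assumed about t0 itself, so this serves points of G and of its
    complement alike.\<close>
  have local: "\<exists>\<delta>>0. \<forall>t t'. \<bar>t - t0\<bar> < \<delta> \<longrightarrow> \<bar>t' - t0\<bar> < \<delta> \<longrightarrow> t \<in> G \<longrightarrow> t' \<in> G" for t0
  proof -
    obtain \<Phi> where "finite \<Phi>" "bounded_below_on (common_kernel \<Phi>) (\<alpha> + t0 *\<^sub>R s)"
      using strictly_singular_perturbation_bounded_below[OF assms(3) c0, of "2 * norm \<alpha> / c0"]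
        skew_norming[OF \<alpha>(1) c0] c0(1) by auto
    then obtain f0 where f0: "f0 \<in> wedge_sums" and
      cases: "bounded_below_on UNIV (\<alpha> + t0 *\<^sub>R s + f0) \<or>
        (\<exists>\<psi>. bounded_below_on UNIV (bordered (\<alpha> + t0 *\<^sub>R s + f0) \<psi>))"
      using wedge_sums_reduction skew_add[OF \<alpha>(1) skew_scaleR[OF \<open>skew s\<close>]] by blast
    define D where "D t = \<alpha> + t *\<^sub>R s + f0" for t
    have skew_D: "skew (D t)" for t
      unfolding D_def by (intro skew_add skew_scaleR \<alpha>(1) \<open>skew s\<close> wedge_sums_skew f0)
    have D_diff: "D t' = D t + (t' - t) *\<^sub>R s" for t t'
      unfolding D_def by (simp add: algebra_simps)
    from cases show ?thesis
    proof
      assume "bounded_below_on UNIV (\<alpha> + t0 *\<^sub>R s + f0)"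
      then obtain c where c: "c > 0" "\<And>x. c * norm x \<le> norm (D t0 x)"
        unfolding bounded_below_on_def D_def by auto
      \<comment> \<open>Near t0 the lower bound of D t is c / 2, which tolerates a change of c / 8;
        going from t to t' via t0 costs twice c / 16.\<close>
      obtain \<delta> where "\<delta> > 0" and \<delta>s: "\<delta> * norm s \<le> c / 16"
        using exists_small_multiple[of "c / 16" "norm s"] c(1) by auto
      have near: "norm ((t - t0) *\<^sub>R s) \<le> c / 16" if "\<bar>t - t0\<bar> < \<delta>" for t
        using that \<delta>s mult_right_mono[of "\<bar>t - t0\<bar>" \<delta> "norm s"] by simp
      have "t' \<in> G" if t: "\<bar>t - t0\<bar> < \<delta>" "\<bar>t' - t0\<bar> < \<delta>" "t \<in> G" for t t'
      proof -
        have lower: "(c / 2) * norm x \<le> norm (D t x)" for x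
          unfolding D_diff[of t t0] using near[OF t(1)] c by (intro bounded_below_perturb) auto
        then have bb: "bounded_below_on UNIV (D t)"
          unfolding bounded_below_on_def using c(1) by (intro exI[of _ "c / 2"]) auto
        obtain f where f: "f \<in> wedge_sums" "symplectic_isomorphism (\<alpha> + t *\<^sub>R s + f)"
          "symplectically_equivalent \<alpha> (\<alpha> + t *\<^sub>R s + f)"
          using t(3) unfolding G_def by blast
        have ff: "f0 - f \<in> wedge_sums"
          using f0 f(1) by (rule wedge_sums_diff)
        have D_t: "D t = (\<alpha> + t *\<^sub>R s + f) + (f0 - f)"
          unfolding D_def by simp
        have "bij (\<alpha> + t *\<^sub>R s + f)"
          using f(2) isomorphism_bij unfolding symplectic_isomorphism_iff by blast
        moreover have "inj (D t)"
          using bounded_below_on_injD[OF bb UNIV_I] by (rule blinfun_injI)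
        ultimately have "surj (D t)"
          unfolding D_t using wedge_sums_finite_rank[OF ff] by (intro finite_rank_inj_imp_surj)
        then have sympl_t: "symplectic_isomorphism (D t)"
          unfolding symplectic_isomorphism_iff isomorphism_iff_bounded_below
          using bb skew_D by blast
        then have equiv_t: "symplectically_equivalent \<alpha> (D t)"
          using f(3) wedge_sums_equivalent[OF ff f(2)] symplectically_equivalent_trans
          unfolding D_t by blast
        have "norm ((t' - t) *\<^sub>R s) = norm ((t' - t0) *\<^sub>R s - (t - t0) *\<^sub>R s)"
          by (simp add: algebra_simps)
        also have "\<dots> \<le> (c / 2) / 4"
          using near[OF t(1)] near[OF t(2)]
            norm_triangle_ineq4[of "(t' - t0) *\<^sub>R s" "(t - t0) *\<^sub>R s"] by linarith
        finally have "norm ((t' - t) *\<^sub>R s) \<le> (c / 2) / 4" .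
        then have "symplectic_isomorphism (D t')" "symplectically_equivalent (D t') (D t)"
          unfolding D_diff[of t' t] using c(1) lower sympl_t skew_scaleR[OF \<open>skew s\<close>]
          by (intro symplectic_isomorphism_perturb[of "D t" "c / 2"]; simp)+
        then show ?thesis
          using f0 equiv_t symplectically_equivalent_sym symplectically_equivalent_trans
          unfolding G_def D_def by blast
      qed
      then show ?thesis
        using \<open>\<delta> > 0\<close> by blast
    next
      assume "\<exists>\<psi>. bounded_below_on UNIV (bordered (\<alpha> + t0 *\<^sub>R s + f0) \<psi>)"
      then obtain \<psi> c where c: "c > 0" "\<And>p. c * norm p \<le> norm (bordered (D t0) \<psi> p)"
        unfolding bounded_below_on_def D_def by auto
      let ?L = "lift_fst s :: ('a \<times> real) \<Rightarrow>\<^sub>L ('a \<times> real) dual"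
      obtain \<delta> where "\<delta> > 0" and \<delta>L: "\<delta> * norm ?L \<le> c / 2"
        using exists_small_multiple[of "c / 2" "norm ?L"] c(1) by auto
      \<comment> \<open>Here the local statement holds because its premise t \<in> G fails.\<close>
      have "t \<notin> G" if "\<bar>t - t0\<bar> < \<delta>" for t
      proof
        assume "t \<in> G"
        have "norm ((t - t0) *\<^sub>R ?L) \<le> c / 2"
          using that \<delta>L mult_right_mono[of "\<bar>t - t0\<bar>" \<delta> "norm ?L"] by simp
        moreover have "bordered (D t) \<psi> = bordered (D t0) \<psi> + (t - t0) *\<^sub>R ?L"
          unfolding D_diff[of t t0] bordered_def lift_fst_add lift_fst_scaleR by simp
        ultimately have "(c / 2) * norm p \<le> norm (bordered (D t) \<psi> p)" for p
          using bounded_below_perturb[OF c(2)] by simp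
        then have bb: "bounded_below_on UNIV (bordered (D t) \<psi>)"
          unfolding bounded_below_on_def using c(1) by (intro exI[of _ "c / 2"]) auto
        obtain f where f: "f \<in> wedge_sums" "symplectic_isomorphism (\<alpha> + t *\<^sub>R s + f)"
          using \<open>t \<in> G\<close> unfolding G_def by blast
        have "D t = (\<alpha> + t *\<^sub>R s + f) + (f0 - f)"
          unfolding D_def by simp
        then show False
          using bordered_not_bounded_below[OF f(2) wedge_sums_diff[OF f0 f(1)]] bb by simp
      qed
      then show ?thesis
        using \<open>\<delta> > 0\<close> by blast
    qed
  qed
  have "open G"
    unfolding open_dist
  proof
    fix t0 assume "t0 \<in> G"
    then show "\<exists>\<delta>>0. \<forall>t. dist t t0 < \<delta> \<longrightarrow> t \<in> G"
      using local[of t0] by (force simp: dist_real_def)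
  qed
  moreover have "open (- G)"
    unfolding open_dist
  proof
    fix t0 assume "t0 \<in> - G"
    then show "\<exists>\<delta>>0. \<forall>t. dist t t0 < \<delta> \<longrightarrow> t \<in> - G"
      using local[of t0] by (force simp: dist_real_def)
  qed
  ultimately have "G = {} \<or> G = UNIV"
    using clopen[of G] by (simp add: closed_def)
  moreover have "0 \<in> G"
    using wedge_sums_equivalent[OF wedge_sums_0 assms(2)] assms(2) wedge_sums_0
    unfolding G_def by (intro CollectI bexI[of _ 0]) auto
  ultimately have "1 \<in> G" by blast
  then obtain f where f: "f \<in> wedge_sums" "symplectic_isomorphism (\<alpha> + s + f)"
    "symplectically_equivalent \<alpha> (\<alpha> + s + f)"
    unfolding G_def by auto
  have "symplectically_equivalent (\<alpha> + s) (\<alpha> + s + f)"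
    using f(1) assms(4) f(2) by (rule wedge_sums_equivalent)
  then show ?thesis
    using f(3) symplectically_equivalent_sym symplectically_equivalent_trans by blast
qed

end
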